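(* A pair $(u_h,\widetilde{\mathtt d}_h)\in\mathcal S^1(\mathcal T_h)\times\mathcal S^1(\mathcal S_h^I)$ is minimal for $E_h$ if and only if the following optimality conditions are satisfied: (i) there exists a constant $\mathtt C_{u_h}>0$ such that $$\mathtt C_{u_h}=\tfrac1{\beta m}\|I_h\{(|u_h-u_\infty^h|-\mathtt C_{u_h})_+\}\|_{1,\Gamma_I};$$ (ii) the function $\widetilde{\mathtt d}_h\in\mathcal S^1(\mathcal S_h^I)$ satisfies $$\widetilde{\mathtt d}_h=\tfrac1{\beta\mathtt C_{u_h}}I_h\{(|u_h-u_\infty^h|-\mathtt C_{u_h})_+\}\quad\text{on }\Gamma_I;$$ (iii) for every $v_h\in\mathcal S^1(\mathcal T_h)$, $$\kappa(\nabla u_h,\nabla v_h)_\Omega+\beta((1+\beta\widetilde{\mathtt d}_h)^{-1}(u_h-u_\infty^h),v_h)_{\Gamma_I,h}=(f_h,v_h)_\Omega+(g_h,v_h)_{\Gamma_N}.$$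
   Context: Let $d\in\{2,3\}$ and let $\Omega\subseteq\mathbb R^d$ be a bounded polyhedral Lipschitz domain whose boundary is disjointly split into relatively open parts $\Gamma_I\neq\emptyset$ and $\Gamma_N$ with $\partial\Omega=\overline\Gamma_I\cup\overline\Gamma_N$. $(\cdot,\cdot)_\omega$ is the $L^2(\omega)$ inner product (surface measure on boundary parts), $\|\cdot\|_{p,\omega}$ the $L^p(\omega)$ norm, $\|\cdot\|_\omega:=\|\cdot\|_{2,\omega}$, $(\cdot)_+:=\max\{\cdot,0\}$, and $\kappa,\beta,m>0$ are given. $\mathcal T_h$ is a member of a shape-regular family of (conforming, simplicial) triangulations of $\Omega$. The boundary facets split disjointly into the facets $\mathcal S_h^I$ contained in $\overline\Gamma_I$ and $\mathcal S_h^N$ contained in $\overline\Gamma_N$. $\mathcal S^1(\mathcal T_h)$ is the space of continuous, element-wise affine functions on $\overline\Omega$; $\mathcal S^1(\mathcal S_h^X)$, $X\in\{I,N\}$, the space of continuous, facet-wise affine functions on $\overline\Gamma_X$. $I_h:C^0(\overline\Gamma_I)\to\mathcal S^1(\mathcal S_h^I)$ is nodal interpolation (at the mesh nodes in $\overline\Gamma_I$); for $v,w\in C^0(\overline\Gamma_I)$, $(v,w)_{\Gamma_I,h}:=(I_h\{vw\},1)_{\Gamma_I}$ and $\|v\|_{\Gamma_I,h}:=(v,v)_{\Gamma_I,h}^{1/2}$. Discrete data: $f_h\in\mathcal S^1(\mathcal T_h)$, $g_h\in\mathcal S^1(\mathcal S_h^N)$ with $(f_h,1)_\Omega+(g_h,1)_{\Gamma_N}\neq0$,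 and $u_\infty^h\in\mathcal S^1(\mathcal S_h^I)$. Set $$\mathcal H_m^h:=\{\eta_h\in\mathcal S^1(\mathcal S_h^I)\mid\eta_h\ge0\text{ on }\Gamma_I,\ (\eta_h,1)_{\Gamma_I,h}=m\},$$ $$E_h(v_h,\eta_h):=\tfrac\kappa2\|\nabla v_h\|_\Omega^2+\tfrac\beta2\|(1+\beta\eta_h)^{-1/2}(v_h-u_\infty^h)\|_{\Gamma_I,h}^2-(f_h,v_h)_\Omega-(g_h,v_h)_{\Gamma_N}\ \text{ if }\eta_h\in\mathcal H_m^h,\quad E_h(v_h,\eta_h):=+\infty\text{ otherwise},$$ for $(v_h,\eta_h)\in\mathcal S^1(\mathcal T_h)\times\mathcal S^1(\mathcal S_h^I)$. *)

theory Defs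
  imports "HOL-Analysis.Analysis"
begin

section \<open>Domains\<close>

(* Near every boundary point, the domain is the part strictly above the graph of a Lipschitz
   function over the hyperplane orthogonal to a unit vector e; y - (y \<bullet> e) *\<^sub>R e is the
   component of y in that hyperplane, so only the values of \<phi> on the hyperplane matter. *)
definition lipschitz_boundary :: "'a::euclidean_space set \<Rightarrow> bool" where
  "lipschitz_boundary \<Omega> \<longleftrightarrow>
     (\<forall>x \<in> frontier \<Omega>. \<exists>r>0. \<exists>e L. \<exists>\<phi> :: 'a \<Rightarrow> real.
        norm e = 1 \<and> L-lipschitz_on UNIV \<phi> \<and>
        \<Omega> \<inter> ball x r = {y \<in> ball x r. \<phi> (y - (y \<bullet> e) *\<^sub>R e) < y \<bullet> e})"

definition bounded_polyhedral_lipschitz_domain :: "'a::euclidean_space set \<Rightarrow> bool" where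
  "bounded_polyhedral_lipschitz_domain \<Omega> \<longleftrightarrow>
     open \<Omega> \<and> connected \<Omega> \<and> \<Omega> \<noteq> {} \<and> bounded \<Omega> \<and>
     (\<exists>\<P>. finite \<P> \<and> (\<forall>P \<in> \<P>. polytope P) \<and> closure \<Omega> = \<Union>\<P>) \<and>
     lipschitz_boundary \<Omega>"

definition boundary_split :: "'a::euclidean_space set \<Rightarrow> 'a set \<Rightarrow> 'a set \<Rightarrow> bool" where
  "boundary_split \<Omega> \<Gamma>I \<Gamma>N \<longleftrightarrow>
     openin (top_of_set (frontier \<Omega>)) \<Gamma>I \<and> openin (top_of_set (frontier \<Omega>)) \<Gamma>N \<and>
     \<Gamma>I \<inter> \<Gamma>N = {} \<and> \<Gamma>I \<noteq> {} \<and> frontier \<Omega> = closure \<Gamma>I \<union> closure \<Gamma>N"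


section \<open>Meshes\<close>

(* "triangulation" from the library expresses conformity: any two members meet in a common face. *)
definition triangulation_of :: "'a::euclidean_space set \<Rightarrow> 'a set set \<Rightarrow> bool" where
  "triangulation_of \<Omega> \<T> \<longleftrightarrow>
     triangulation \<T> \<and> (\<forall>T \<in> \<T>. int DIM('a) simplex T) \<and> \<Union>\<T> = closure \<Omega>"

definition inradius :: "'a::euclidean_space set \<Rightarrow> real" where
  "inradius T = Sup {r. \<exists>x. cball x r \<subseteq> T}"

definition shape_regular_family :: "'a::euclidean_space set \<Rightarrow> 'a set set set \<Rightarrow> bool" where
  "shape_regular_family \<Omega> \<TT> \<longleftrightarrow>
     (\<forall>\<T> \<in> \<TT>. triangulation_of \<Omega> \<T>) \<and>
     (\<exists>\<sigma>>0. \<forall>\<T> \<in> \<TT>. \<forall>T \<in> \<T>. diameter T \<le> \<sigma> * inradius T)"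

definition mesh_nodes :: "'a::euclidean_space set set \<Rightarrow> 'a set" where
  "mesh_nodes \<T> = {z. \<exists>T \<in> \<T>. z extreme_point_of T}"

definition boundary_facets :: "'a::euclidean_space set \<Rightarrow> 'a set set \<Rightarrow> 'a set set" where
  "boundary_facets \<Omega> \<T> = {F. (\<exists>T \<in> \<T>. F facet_of T) \<and> F \<subseteq> frontier \<Omega>}"

definition facets_on :: "'a::euclidean_space set \<Rightarrow> 'a set set \<Rightarrow> 'a set \<Rightarrow> 'a set set" where
  "facets_on \<Omega> \<T> \<Gamma> = {F \<in> boundary_facets \<Omega> \<T>. F \<subseteq> closure \<Gamma>}"

definition facets_split ::
    "'a::euclidean_space set \<Rightarrow> 'a set set \<Rightarrow> 'a set \<Rightarrow> 'a set \<Rightarrow> bool" where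
  "facets_split \<Omega> \<T> \<Gamma>I \<Gamma>N \<longleftrightarrow>
     boundary_facets \<Omega> \<T> = facets_on \<Omega> \<T> \<Gamma>I \<union> facets_on \<Omega> \<T> \<Gamma>N \<and>
     facets_on \<Omega> \<T> \<Gamma>I \<inter> facets_on \<Omega> \<T> \<Gamma>N = {}"


section \<open>Finite element spaces\<close>

definition affine_fun_on :: "'a::euclidean_space set \<Rightarrow> ('a \<Rightarrow> real) \<Rightarrow> bool" where
  "affine_fun_on S v \<longleftrightarrow> (\<exists>a c. \<forall>x \<in> S. v x = a \<bullet> x + c)"

(* A function on a subset of the space is represented by any total function extending it;
   all notions below depend only on the values on the subset in question. *)
definition S1 :: "'a::euclidean_space set \<Rightarrow> 'a set set \<Rightarrow> ('a \<Rightarrow> real) set" where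
  "S1 \<Omega> \<T> = {v. continuous_on (closure \<Omega>) v \<and> (\<forall>T \<in> \<T>. affine_fun_on T v)}"

definition S1_bd ::
    "'a::euclidean_space set \<Rightarrow> 'a set set \<Rightarrow> 'a set \<Rightarrow> ('a \<Rightarrow> real) set" where
  "S1_bd \<Omega> \<T> \<Gamma> =
     {v. continuous_on (closure \<Gamma>) v \<and> (\<forall>F \<in> facets_on \<Omega> \<T> \<Gamma>. affine_fun_on F v)}"

(* The value 0 off closure \<Gamma> only serves to single out one representative. *)
definition nodal_interp ::
    "'a::euclidean_space set \<Rightarrow> 'a set set \<Rightarrow> 'a set \<Rightarrow> ('a \<Rightarrow> real) \<Rightarrow> 'a \<Rightarrow> real" where
  "nodal_interp \<Omega> \<T> \<Gamma> v =
     (THE w. w \<in> S1_bd \<Omega> \<T> \<Gamma> \<and> (\<forall>z \<in> mesh_nodes \<T> \<inter> closure \<Gamma>. w z = v z) \<and>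
             (\<forall>x. x \<notin> closure \<Gamma> \<longrightarrow> w x = 0))"


section \<open>Integrals, inner products and norms\<close>

definition ip_L2 :: "'a::euclidean_space set \<Rightarrow> ('a \<Rightarrow> 'b::real_inner) \<Rightarrow> ('a \<Rightarrow> 'b) \<Rightarrow> real" where
  "ip_L2 \<Omega> v w = (LINT x:\<Omega>|lebesgue. v x \<bullet> w x)"

definition norm_L2 :: "'a::euclidean_space set \<Rightarrow> ('a \<Rightarrow> 'b::real_inner) \<Rightarrow> real" where
  "norm_L2 \<Omega> v = sqrt (ip_L2 \<Omega> v v)"

(* For v \<in> S1 \<Omega> \<T> this is the element-wise gradient in the interior of each element; the
   remaining points of \<Omega> form a null set, where the value is irrelevant for integrals with
   respect to the (complete) measure lebesgue. *)
definition grad :: "('a::euclidean_space \<Rightarrow> real) \<Rightarrow> 'a \<Rightarrow> 'a" where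
  "grad v x = (\<Sum>b\<in>Basis. frechet_derivative v (at x) b *\<^sub>R b)"

(* For aff_dim F = DIM('a) - 1: the (DIM('a) - 1)-dimensional Lebesgue measure on the hyperplane
   H = affine hull F, obtained by projecting Lebesgue measure on the slab of thickness 1
   around H orthogonally onto H. *)
definition hyperplane_measure :: "'a::euclidean_space set \<Rightarrow> 'a measure" where
  "hyperplane_measure F =
     distr (restrict_space lborel {x. infdist x (affine hull F) \<le> 1/2}) borel
           (closest_point (affine hull F))"

(* Integral of f over a part \<Gamma> of the boundary with respect to surface measure. The boundary
   facets cover the boundary and intersect pairwise in sets of surface measure zero, so
   the facet-wise contributions add up. *)
definition surface_integral ::
    "'a::euclidean_space set \<Rightarrow> 'a set set \<Rightarrow> 'a set \<Rightarrow> ('a \<Rightarrow> real) \<Rightarrow> real" where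
  "surface_integral \<Omega> \<T> \<Gamma> f =
     (\<Sum>F \<in> boundary_facets \<Omega> \<T>. LINT x:F \<inter> \<Gamma>|hyperplane_measure F. f x)"

definition ip_bd ::
    "'a::euclidean_space set \<Rightarrow> 'a set set \<Rightarrow> 'a set \<Rightarrow> ('a \<Rightarrow> real) \<Rightarrow> ('a \<Rightarrow> real) \<Rightarrow> real" where
  "ip_bd \<Omega> \<T> \<Gamma> v w = surface_integral \<Omega> \<T> \<Gamma> (\<lambda>x. v x * w x)"

definition norm_L1_bd ::
    "'a::euclidean_space set \<Rightarrow> 'a set set \<Rightarrow> 'a set \<Rightarrow> ('a \<Rightarrow> real) \<Rightarrow> real" where
  "norm_L1_bd \<Omega> \<T> \<Gamma> v = surface_integral \<Omega> \<T> \<Gamma> (\<lambda>x. \<bar>v x\<bar>)"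

definition ip_lumped ::
    "'a::euclidean_space set \<Rightarrow> 'a set set \<Rightarrow> 'a set \<Rightarrow> ('a \<Rightarrow> real) \<Rightarrow> ('a \<Rightarrow> real) \<Rightarrow> real" where
  "ip_lumped \<Omega> \<T> \<Gamma> v w = ip_bd \<Omega> \<T> \<Gamma> (nodal_interp \<Omega> \<T> \<Gamma> (\<lambda>x. v x * w x)) (\<lambda>_. 1)"

definition norm_lumped ::
    "'a::euclidean_space set \<Rightarrow> 'a set set \<Rightarrow> 'a set \<Rightarrow> ('a \<Rightarrow> real) \<Rightarrow> real" where
  "norm_lumped \<Omega> \<T> \<Gamma> v = sqrt (ip_lumped \<Omega> \<T> \<Gamma> v v)"

definition pos_part :: "real \<Rightarrow> real" where
  "pos_part t = max t 0"


section \<open>The discrete energy\<close>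

definition H_adm ::
    "'a::euclidean_space set \<Rightarrow> 'a set set \<Rightarrow> 'a set \<Rightarrow> real \<Rightarrow> ('a \<Rightarrow> real) set" where
  "H_adm \<Omega> \<T> \<Gamma>I m =
     {\<eta> \<in> S1_bd \<Omega> \<T> \<Gamma>I. (\<forall>x \<in> \<Gamma>I. 0 \<le> \<eta> x) \<and> ip_lumped \<Omega> \<T> \<Gamma>I \<eta> (\<lambda>_. 1) = m}"

definition E_h ::
    "'a::euclidean_space set \<Rightarrow> 'a set set \<Rightarrow> 'a set \<Rightarrow> 'a set \<Rightarrow> real \<Rightarrow> real \<Rightarrow> real \<Rightarrow>
     ('a \<Rightarrow> real) \<Rightarrow> ('a \<Rightarrow> real) \<Rightarrow> ('a \<Rightarrow> real) \<Rightarrow> ('a \<Rightarrow> real) \<Rightarrow> ('a \<Rightarrow> real) \<Rightarrow> ereal" where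
  "E_h \<Omega> \<T> \<Gamma>I \<Gamma>N \<kappa> \<beta> m f g uinf v \<eta> =
     (if \<eta> \<in> H_adm \<Omega> \<T> \<Gamma>I m
      then ereal (\<kappa> / 2 * (norm_L2 \<Omega> (grad v))\<^sup>2
             + \<beta> / 2 * (norm_lumped \<Omega> \<T> \<Gamma>I (\<lambda>x. (1 + \<beta> * \<eta> x) powr (- 1 / 2) * (v x - uinf x)))\<^sup>2
             - ip_L2 \<Omega> f v - ip_bd \<Omega> \<T> \<Gamma>N g v)
      else \<infinity>)"

end

theory Submission
  imports Defs
begin

(* Mass lumping turns a boundary integral into a sum over the boundary nodes with positive weights,
   so in (a, s) = (v - uinf, 1 + \<beta> \<eta>) the boundary term is a weighted sum of the jointly convex
   functions a^2 / s. If (i)-(iii) hold, then |a| / s = min |a| C at every node, with equality to C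
   wherever \<delta> > 0, and the tangent plane inequality at (u, \<delta>) together with the mass constraint
   gives minimality. Conversely, (iii) is stationarity in v, and moving mass between two nodes shows
   that |a| / s attains its maximum C at all nodes carrying mass, which is (i) and (ii); C > 0 because
   otherwise testing (iii) with a constant contradicts the nonzero total load.
   That the lumped weights exist and are positive rests on geometry: the Lipschitz property
   excludes slits, so the frontier is the union of the boundary facets. *)

section \<open>Frontiers of simplicial meshes\<close>

text \<open>The definite description in \<open>nodal_interp\<close> has a solution, and only one, if
  nodal values can be prescribed freely and determine a function of \<open>S1_bd\<close>; the latter
  requires \<open>closure \<Gamma>I\<close> to be a union of facets. This is the obstacle that
  shapes the geometric part: a piece of \<open>frontier \<Omega>\<close> with the domain on both
  sides could run through the interior of an element, where no facet sees it. Moreover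
  \<open>\<Gamma>I\<close> is only relatively open and may omit a set of positive surface measure
  from its facets, so positive weights come from a relatively open piece of a facet rather than from
  the whole facet, and statements on \<open>\<Gamma>I\<close> reach the nodes, which may lie only in
  its closure, by continuity. Once every vector of nodal values is known to have an interpolant,
  distributions can be varied node by node without leaving the finite element space. Finally, the
  energy is infinite off \<open>H_adm\<close>, so every pair would be minimal if nothing were
  admissible; a constant distribution of mass \<open>m\<close> excludes this.\<close>

text \<open>Adding the part \<open>t\<close> of \<open>a'\<close> orthogonal to \<open>a\<close> to
  a point \<open>p\<close> of the common hyperplane does not leave it, so
  \<open>a' \<bullet> t = 0\<close> and \<open>t\<close> vanishes.\<close>

lemma hyperplane_eq_imp_parallel:
  fixes a a' :: "'a::euclidean_space"
  assumes "{x. a \<bullet> x = b} = {x. a' \<bullet> x = b'}" "a \<noteq> 0"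
  obtains c where "a' = c *\<^sub>R a" "b' = c * b"
proof -
  define c where "c = (a' \<bullet> a) / (a \<bullet> a)"
  define t where "t = a' - c *\<^sub>R a"
  define p where "p = (b / (a \<bullet> a)) *\<^sub>R a"
  have at: "a \<bullet> t = 0"
    using assms(2) by (simp add: t_def c_def inner_diff_right inner_commute)
  have ap: "a \<bullet> p = b"
    using assms(2) by (simp add: p_def)
  have p': "a' \<bullet> p = b'"
    using ap assms(1) by blast
  have "a \<bullet> (p + t) = b"
    using at ap by (simp add: inner_add_right)
  then have "a' \<bullet> (p + t) = b'"
    using assms(1) by blast
  then have "a' \<bullet> t = 0"
    using p' by (simp add: inner_add_right)
  then have "t \<bullet> t = 0"
    using at by (simp add: t_def inner_diff_left)
  then have "a' = c *\<^sub>R a"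
    by (simp add: t_def)
  then show thesis
    using that ap p' by auto
qed

lemma affine_hull_facet_eq_hyperplane:
  fixes P :: "'a::euclidean_space set"
  assumes "F facet_of P" "aff_dim P = DIM('a)" "F \<subseteq> {x. a \<bullet> x = b}" "a \<noteq> 0"
  shows "affine hull F = {x. a \<bullet> x = b}"
proof (rule affine_dim_equal)
  show "affine hull F \<subseteq> {x. a \<bullet> x = b}"
    using assms(3) affine_hyperplane by (rule hull_minimal)
  show "aff_dim (affine hull F) = aff_dim {x. a \<bullet> x = b}"
    using assms by (simp add: facet_of_def aff_dim_hyperplane)
  show "affine hull F \<noteq> {}"
    using assms(1) by (simp add: facet_of_def)
qed (auto simp: affine_hyperplane)

text \<open>A face that meets the relative interior of \<open>F\<close> contains \<open>F\<close>,
  and \<open>F\<close>, as a proper face of \<open>G\<close>, would have smaller dimension than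
  \<open>G\<close>.\<close>

lemma facet_of_eqI:
  fixes P :: "'a::euclidean_space set"
  assumes "convex P" "F facet_of P" "G facet_of P" "p \<in> rel_interior F" "p \<in> G"
  shows "F = G"
proof (rule ccontr)
  assume "F \<noteq> G"
  have "F \<subseteq> G"
    using subset_of_face_of[of G P F] assms by (auto simp: facet_of_def face_of_imp_subset)
  moreover have "F face_of G"
    using assms \<open>F \<subseteq> G\<close> by (meson face_of_face facet_of_imp_face_of)
  ultimately have "aff_dim F < aff_dim G"
    using face_of_aff_dim_lt[of G F] \<open>F \<noteq> G\<close> assms
    by (metis face_of_imp_convex facet_of_imp_face_of)
  then show False
    using assms by (simp add: facet_of_def)
qed

text \<open>In a minimal representation by half-spaces, every constraint active at a relative
  interior point of \<open>F\<close> describes the same half-space as the one defining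
  \<open>F\<close>; the finitely many inactive ones hold strictly nearby. So the polyhedron looks
  like a half-space there.\<close>

lemma polyhedron_near_facet:
  fixes P :: "'a::euclidean_space set"
  assumes P: "polyhedron P" "aff_dim P = DIM('a)" and F: "F facet_of P"
  obtains a b where "a \<noteq> 0" "affine hull F = {x. a \<bullet> x = b}" "P \<subseteq> {x. a \<bullet> x \<le> b}"
    "\<And>p. p \<in> rel_interior F \<Longrightarrow> \<exists>r>0. ball p r \<inter> {x. a \<bullet> x \<le> b} \<subseteq> P"
proof -
  have hull: "affine hull P = UNIV"
    using P(2) by (simp add: aff_dim_eq_full)
  obtain G where G: "finite G" "P = (affine hull P) \<inter> \<Inter>G"
      and 1: "\<forall>h\<in>G. \<exists>a b. a \<noteq> 0 \<and> h = {x. a \<bullet> x \<le> b}"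
      and min: "\<And>F'. F' \<subset> G \<Longrightarrow> P \<subset> (affine hull P) \<inter> \<Inter>F'"
    using P(1) polyhedron_Int_affine_minimal[of P] by auto
  then obtain a b where ab: "\<And>h. h \<in> G \<Longrightarrow> a h \<noteq> 0 \<and> h = {x. a h \<bullet> x \<le> b h}"
    by metis
  have nz: "a h' \<noteq> 0" if "h' \<in> G" for h'
    using ab[OF that] by blast
  have PG: "P = \<Inter>G"
    using G(2) hull by simp
  note explicit = facet_of_polyhedron_explicit[OF G ab min]
  obtain h where h: "h \<in> G" and Fh: "F = P \<inter> {x. a h \<bullet> x = b h}"
    using explicit F by blast
  have mem: "x \<in> h' \<longleftrightarrow> a h' \<bullet> x \<le> b h'" if "h' \<in> G" for h' x
    using ab[OF that] by blast
  have le: "a h' \<bullet> x \<le> b h'" if "h' \<in> G" "x \<in> P" for h' x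
    using that mem[of h'] unfolding PG by blast
  have hullF: "affine hull F = {x. a h \<bullet> x = b h}"
    using affine_hull_facet_eq_hyperplane[OF F P(2)] Fh nz[OF h] by auto
  have "\<exists>r>0. ball p r \<inter> {x. a h \<bullet> x \<le> b h} \<subseteq> P" if p: "p \<in> rel_interior F" for p
  proof -
    have pF: "p \<in> F"
      using p rel_interior_subset by blast
    have sub: "h \<subseteq> h'" if h': "h' \<in> G" "a h' \<bullet> p = b h'" for h'
    proof -
      define F' where "F' = P \<inter> {x. a h' \<bullet> x = b h'}"
      have F': "F' facet_of P"
        using explicit h' F'_def by blast
      have "F = F'"
        using facet_of_eqI[OF _ F F' p] P(1) pF h' Fh F'_def by (simp add: polyhedron_imp_convex)
      then have "affine hull F = {x. a h' \<bullet> x = b h'}"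
        using affine_hull_facet_eq_hyperplane[OF F P(2)] F'_def nz[OF h'(1)] by auto
      then obtain c where c: "a h' = c *\<^sub>R a h" "b h' = c * b h"
        using hyperplane_eq_imp_parallel[of "a h" "b h" "a h'" "b h'"] hullF nz[OF h] by metis
      \<comment> \<open>Opposite normals would squeeze \<open>P\<close> between the two half-spaces
        into the hyperplane, and the facet would be all of \<open>P\<close>.\<close>
      have "c \<ge> 0"
      proof (rule ccontr)
        assume "\<not> c \<ge> 0"
        then have "P \<subseteq> {x. a h \<bullet> x = b h}"
          using le[OF h] le[OF h'(1)] c by (fastforce intro: antisym)
        then have "F = P"
          using Fh by auto
        then show False
          using F by simp
      qed
      then show ?thesis
        using mem[OF h] mem[OF h'(1)] c by (auto intro: mult_left_mono)
    qed
    \<comment> \<open>The inactive constraints, made strict: an open neighbourhood of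
      \<open>p\<close> in which only the active ones can fail.\<close>
    define U where "U = (\<Inter>h' \<in> {h' \<in> G. a h' \<bullet> p \<noteq> b h'}. {x. a h' \<bullet> x < b h'})"
    have "open U"
      unfolding U_def using G(1) by (intro open_INT) (auto simp: open_halfspace_lt)
    moreover have "p \<in> U"
      using le pF Fh by (force simp: U_def order_le_less)
    ultimately obtain r where r: "r > 0" "ball p r \<subseteq> U"
      by (meson open_contains_ball)
    have "x \<in> P" if x: "x \<in> ball p r" "a h \<bullet> x \<le> b h" for x
    proof -
      have "x \<in> h'" if "h' \<in> G" for h'
      proof (cases "a h' \<bullet> p = b h'")
        case True
        then show ?thesis
          using sub[OF that] mem[OF h] x by blast
      next
        case False
        then have "a h' \<bullet> x < b h'"
          using r x that by (auto simp: U_def)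
        then show ?thesis
          using mem[OF that] by simp
      qed
      then show ?thesis
        by (simp add: PG)
    qed
    then show ?thesis
      using r by auto
  qed
  then show thesis
    using that[of "a h" "b h"] nz[OF h] hullF le[OF h] by auto
qed

lemma affine_hull_insert_lowdim_negligible:
  fixes G :: "'a::euclidean_space set"
  assumes "aff_dim G \<le> int DIM('a) - 2"
  shows "negligible (affine hull (insert a G))"
proof -
  have "aff_dim (affine hull (insert a G)) < DIM('a)"
    using assms by (simp add: aff_dim_insert)
  then obtain n c where "n \<noteq> 0" "affine hull (insert a G) \<subseteq> {x. n \<bullet> x = c}"
    by (rule aff_lowdim_subset_hyperplane)
  then show ?thesis
    using negligible_hyperplane negligible_subset by blast
qed

(* Since a cone over a set of codimension 2 is negligible, a segment leaving S from an interior
   point can be chosen to miss that set. *)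
lemma frontier_point_avoiding_codim2:
  fixes S :: "'a::euclidean_space set"
  assumes "closed S" "S \<subseteq> closure (interior S)" "x \<in> frontier S" "r > 0"
    and "finite \<G>" "\<And>G. G \<in> \<G> \<Longrightarrow> aff_dim G \<le> int DIM('a) - 2"
  obtains p where "p \<in> frontier S" "p \<in> ball x r" "\<And>G. G \<in> \<G> \<Longrightarrow> p \<notin> G"
proof -
  have "x \<in> closure (interior S)"
    using assms(1-3) frontier_subset_closed by blast
  then obtain a where a: "a \<in> interior S" "a \<in> ball x r"
    using assms(4) by (metis closure_approachable dist_commute mem_ball)
  define O' where "O' = ball x r - S"
  have "x \<in> closure (- S)"
    using assms(3) by (simp add: frontier_closures)
  then have "O' \<noteq> {}"
    using assms(4) unfolding O'_def
    by (metis Compl_iff DiffI closure_approachable dist_commute empty_iff mem_ball)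
  moreover have "open O'"
    unfolding O'_def using assms(1) by blast
  ultimately have "\<not> negligible O'"
    using open_not_negligible by blast
  moreover have "negligible (\<Union>G\<in>\<G>. affine hull (insert a G))"
    using assms(5,6) affine_hull_insert_lowdim_negligible by (intro negligible_Union) auto
  ultimately have "\<not> O' \<subseteq> (\<Union>G\<in>\<G>. affine hull (insert a G))"
    using negligible_subset[of _ O'] by metis
  then obtain b where b: "b \<in> O'" "\<And>G. G \<in> \<G> \<Longrightarrow> b \<notin> affine hull (insert a G)"
    by blast
  have "closed_segment a b \<inter> frontier S \<noteq> {}"
  proof (rule connected_Int_frontier)
    show "closed_segment a b \<inter> S \<noteq> {}"
      using a(1) interior_subset by fastforce
    show "closed_segment a b - S \<noteq> {}"
      using b(1) O'_def by fastforce
  qed simp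
  then obtain p where p: "p \<in> closed_segment a b" "p \<in> frontier S"
    by blast
  have "p \<noteq> a"
    using a(1) p(2) by (auto simp: frontier_def)
  have "p \<notin> G" if "G \<in> \<G>" for G
  proof
    assume "p \<in> G"
    obtain t where t: "p = (1 - t) *\<^sub>R a + t *\<^sub>R b"
      using p(1) by (auto simp: in_segment)
    then have "t \<noteq> 0"
      using \<open>p \<noteq> a\<close> by auto
    \<comment> \<open>Extrapolation along the segment recovers \<open>b\<close> from
      \<open>a\<close> and \<open>p\<close>, so \<open>p\<close> in \<open>G\<close> would put
      \<open>b\<close> into the excluded affine hull.\<close>
    define s where "s = inverse t"
    have "b = (1 - s) *\<^sub>R a + s *\<^sub>R p"
      using \<open>t \<noteq> 0\<close> unfolding t s_def by (simp add: algebra_simps)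
    moreover have "(1 - s) *\<^sub>R a + s *\<^sub>R p \<in> affine hull (insert a G)"
      using \<open>p \<in> G\<close> affine_affine_hull[of "insert a G"]
      by (intro mem_affine) (auto simp: hull_inc)
    ultimately show False
      using b(2)[OF that] by simp
  qed
  moreover have "p \<in> ball x r"
  proof -
    have "closed_segment a b \<subseteq> ball x r"
      using a b by (intro closed_segment_subset) (auto simp: O'_def)
    then show ?thesis
      using p by blast
  qed
  ultimately show thesis
    using that p(2) by blast
qed

section \<open>Facets and frontier of a conforming simplicial mesh\<close>

locale simplicial_mesh =
  fixes \<T> :: "'a::euclidean_space set set"
  assumes finite_mesh: "finite \<T>"
    and simplex_mesh: "\<And>T. T \<in> \<T> \<Longrightarrow> int DIM('a) simplex T"
    and Int_face_of_mesh: "\<And>T T'. T \<in> \<T> \<Longrightarrow> T' \<in> \<T> \<Longrightarrow> (T \<inter> T') face_of T"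
begin

lemma polytope_mesh: "T \<in> \<T> \<Longrightarrow> polytope T"
  using simplex_mesh simplex_imp_polytope by blast

lemma polyhedron_mesh: "T \<in> \<T> \<Longrightarrow> polyhedron T"
  using polytope_mesh polytope_imp_polyhedron by blast

lemma convex_mesh: "T \<in> \<T> \<Longrightarrow> convex T"
  using polytope_mesh polytope_imp_convex by blast

lemma closed_mesh: "T \<in> \<T> \<Longrightarrow> closed T"
  using polytope_mesh polytope_imp_closed by blast

lemma aff_dim_mesh: "T \<in> \<T> \<Longrightarrow> aff_dim T = DIM('a)"
  using simplex_mesh aff_dim_simplex by blast

lemma interior_mesh: "T \<in> \<T> \<Longrightarrow> rel_interior T = interior T"
  using aff_dim_mesh by (simp add: aff_dim_eq_full rel_interior_interior)

lemma closed_Union_mesh: "closed (\<Union>\<T>)"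
  using finite_mesh closed_mesh by blast

text \<open>Conformity transfers faces between elements: \<open>G\<close> is a face of
  \<open>T \<inter> T'\<close>, which is itself a face of \<open>T'\<close>.\<close>

lemma face_of_other:
  assumes "T \<in> \<T>" "T' \<in> \<T>" "G face_of T" "G \<subseteq> T'"
  shows "G face_of T'"
proof -
  have "G face_of (T \<inter> T')"
    using assms face_of_imp_subset[OF assms(3)] by (intro face_of_subset[OF assms(3)]) auto
  moreover have "(T \<inter> T') face_of T'"
    using Int_face_of_mesh[OF assms(2,1)] by (simp add: Int_commute)
  ultimately show ?thesis
    by (rule face_of_trans)
qed

text \<open>The common face \<open>T \<inter> T'\<close> meets the relative interior of
  \<open>F\<close>, so it contains all of \<open>F\<close>; two elements cannot share only a part of
  a facet.\<close>

lemma facet_meets_rel_interior: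
  assumes "T \<in> \<T>" "T' \<in> \<T>" "F facet_of T" "p \<in> rel_interior F" "p \<in> T'"
  shows "F facet_of T'"
proof -
  have "F \<subseteq> T \<inter> T'"
  proof (rule subset_of_face_of)
    show "(T \<inter> T') face_of T"
      using assms Int_face_of_mesh by blast
    show "F \<subseteq> T"
      using assms facet_of_imp_subset by blast
    show "T \<inter> T' \<inter> rel_interior F \<noteq> {}"
      using assms \<open>F \<subseteq> T\<close> rel_interior_subset by blast
  qed
  then have "F face_of T'"
    using face_of_other assms facet_of_imp_face_of by blast
  then show ?thesis
    using assms aff_dim_mesh[OF assms(1)] aff_dim_mesh[OF assms(2)] by (simp add: facet_of_def)
qed

(* An element on the other side of the facet exists near one point of F, hence near all of
   its relative interior. *)
lemma rel_interior_facet_interior: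
  assumes T: "T \<in> \<T>" and F: "F facet_of T"
    and q: "q \<in> rel_interior F" "q \<in> interior (\<Union>\<T>)" and p: "p \<in> rel_interior F"
  shows "p \<in> interior (\<Union>\<T>)"
proof -
  obtain a b where ab: "a \<noteq> 0" "affine hull F = {x. a \<bullet> x = b}" "T \<subseteq> {x. a \<bullet> x \<le> b}"
    and near: "\<And>p. p \<in> rel_interior F \<Longrightarrow> \<exists>r>0. ball p r \<inter> {x. a \<bullet> x \<le> b} \<subseteq> T"
    using polyhedron_near_facet[OF polyhedron_mesh[OF T] aff_dim_mesh[OF T] F] by blast
  have hull: "a \<bullet> x = b" if "x \<in> F" for x
    using ab(2) hull_subset[of F affine] that by blast
  have qF: "q \<in> F" and pF: "p \<in> F"
    using p q rel_interior_subset by blast+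
  \<comment> \<open>Removing the elements that miss \<open>q\<close> forces every mesh point in
    \<open>U\<close> into an element containing \<open>q\<close>.\<close>
  define U where "U = interior (\<Union>\<T>) - \<Union>{T' \<in> \<T>. q \<notin> T'}"
  have "open U"
    unfolding U_def using finite_mesh closed_mesh by (intro open_Diff closed_Union) auto
  moreover have "q \<in> U"
    unfolding U_def using q by blast
  ultimately obtain e where e: "e > 0" "ball q e \<subseteq> U"
    by (meson open_contains_ball)
  \<comment> \<open>Half the radius, scaled by the length of the normal: the point
    \<open>q + s *\<^sub>R a\<close> stays in the ball but lies strictly beyond the hyperplane of
    \<open>F\<close>, outside \<open>T\<close>.\<close>
  define s where "s = e / (2 * norm a)"
  have s: "s > 0"
    using e ab(1) by (simp add: s_def)
  have "q + s *\<^sub>R a \<in> ball q e"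
    using e(1) ab(1) by (simp add: s_def dist_norm)
  then have "q + s *\<^sub>R a \<in> U"
    using e(2) by blast
  then obtain T'' where T'': "T'' \<in> \<T>" "q \<in> T''" "q + s *\<^sub>R a \<in> T''"
    unfolding U_def using interior_subset by blast
  have F'': "F facet_of T''"
    using facet_meets_rel_interior T T'' F q by blast
  obtain a' b' where ab': "a' \<noteq> 0" "affine hull F = {x. a' \<bullet> x = b'}" "T'' \<subseteq> {x. a' \<bullet> x \<le> b'}"
    and near': "\<And>p. p \<in> rel_interior F \<Longrightarrow> \<exists>r>0. ball p r \<inter> {x. a' \<bullet> x \<le> b'} \<subseteq> T''"
    using polyhedron_near_facet[OF polyhedron_mesh[OF T''(1)] aff_dim_mesh[OF T''(1)] F''] by blast
  obtain c where c: "a' = c *\<^sub>R a" "b' = c * b"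
    using hyperplane_eq_imp_parallel[of a b a' b'] ab ab' by metis
  \<comment> \<open>As \<open>T''\<close> reaches beyond the hyperplane, its outer normal at
    \<open>F\<close> cannot point the same way as that of \<open>T\<close>. Hence the half-balls of
    \<open>T\<close> and \<open>T''\<close> at \<open>p\<close> together fill a ball.\<close>
  have "c * (a \<bullet> (q + s *\<^sub>R a)) \<le> c * b"
    using T''(3) ab'(3) c by auto
  then have "c * (s * (a \<bullet> a)) \<le> 0"
    using hull[OF qF] by (simp add: inner_add_right algebra_simps)
  moreover have "s * (a \<bullet> a) > 0"
    using s ab(1) by simp
  ultimately have "c \<le> 0"
    by (metis mult_pos_pos not_le)
  obtain r where r: "r > 0" "ball p r \<inter> {x. a \<bullet> x \<le> b} \<subseteq> T"
    using near[OF p] by blast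
  obtain r' where r': "r' > 0" "ball p r' \<inter> {x. a' \<bullet> x \<le> b'} \<subseteq> T''"
    using near'[OF p] by blast
  have "x \<in> \<Union>\<T>" if "x \<in> ball p (min r r')" for x
  proof (cases "a \<bullet> x \<le> b")
    case True
    then show ?thesis
      using r that T by auto
  next
    case False
    then have "a' \<bullet> x \<le> b'"
      using \<open>c \<le> 0\<close> c by (auto intro: mult_left_mono_neg)
    then show ?thesis
      using r' that T'' by auto
  qed
  then show ?thesis
    using r(1) r'(1) by (intro interiorI[of "ball p (min r r')"]) auto
qed

text \<open>A frontier point away from the closed union of boundary facets could be moved slightly
  along the frontier to avoid all faces of codimension at least 2. It would then lie in the relative
  interior of a facet, and such a facet is either contained in the frontier or has its whole
  relative interior inside the mesh.\<close>

lemma frontier_eq_Union_facets: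
  "frontier (\<Union>\<T>) = \<Union>{F. (\<exists>T\<in>\<T>. F facet_of T) \<and> F \<subseteq> frontier (\<Union>\<T>)}" (is "_ = \<Union>?B")
proof (intro equalityI subsetI)
  fix x assume x: "x \<in> frontier (\<Union>\<T>)"
  show "x \<in> \<Union>?B"
  proof (rule ccontr)
    assume not: "x \<notin> \<Union>?B"
    have finB: "finite ?B"
      by (rule finite_subset[of _ "\<Union>T\<in>\<T>. {F. F facet_of T}"])
        (use finite_mesh polytope_mesh finite_polytope_facets in auto)
    have "\<forall>F\<in>?B. closed F"
      using face_of_imp_closed[OF convex_mesh closed_mesh facet_of_imp_face_of] by blast
    with finB have "closed (\<Union>?B)"
      by (rule closed_Union)
    then have "open (- \<Union>?B)"
      by (rule open_Compl)
    then obtain r where r: "r > 0" "ball x r \<subseteq> - \<Union>?B"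
      using not by (meson ComplI open_contains_ball)
    define \<G> where "\<G> = {G. \<exists>T\<in>\<T>. G face_of T \<and> aff_dim G \<le> int DIM('a) - 2}"
    have "finite \<G>"
      by (rule finite_subset[of _ "\<Union>T\<in>\<T>. {F. F face_of T}"])
        (use finite_mesh polytope_mesh finite_polytope_faces in \<open>auto simp: \<G>_def\<close>)
    have "\<Union>\<T> \<subseteq> closure (interior (\<Union>\<T>))"
    proof
      fix y assume "y \<in> \<Union>\<T>"
      then obtain T where T: "T \<in> \<T>" "y \<in> T"
        by blast
      then have "y \<in> closure (interior T)"
        using convex_closure_rel_interior[OF convex_mesh[OF T(1)]] interior_mesh[OF T(1)]
          closure_subset by auto
      moreover have "interior T \<subseteq> interior (\<Union>\<T>)"
        using T by (intro interior_mono) auto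
      ultimately show "y \<in> closure (interior (\<Union>\<T>))"
        using closure_mono by blast
    qed
    then obtain p where p: "p \<in> frontier (\<Union>\<T>)" "p \<in> ball x r" "\<And>G. G \<in> \<G> \<Longrightarrow> p \<notin> G"
      using frontier_point_avoiding_codim2[OF closed_Union_mesh _ x r(1) \<open>finite \<G>\<close>]
      unfolding \<G>_def by blast
    obtain T where T: "T \<in> \<T>" "p \<in> T"
      using p(1) closed_Union_mesh frontier_subset_closed by blast
    have "interior T \<subseteq> interior (\<Union>\<T>)"
      using T by (intro interior_mono) auto
    then have "p \<in> rel_frontier T"
      using T p(1) interior_mesh[OF T(1)] closed_mesh[OF T(1)]
      by (auto simp: rel_frontier_def frontier_def)
    then obtain F where F: "F facet_of T" "p \<in> F"
      using rel_frontier_of_polyhedron[OF polyhedron_mesh[OF T(1)]] by blast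
    have polyF: "polyhedron F"
      using F polyhedron_mesh[OF T(1)] face_of_polyhedron_polyhedron facet_of_imp_face_of by blast
    have pF: "p \<in> rel_interior F"
    proof (rule ccontr)
      assume "p \<notin> rel_interior F"
      then have "p \<in> rel_frontier F"
        using F(2) polyhedron_imp_closed[OF polyF] by (simp add: rel_frontier_def)
      then obtain G where G: "G facet_of F" "p \<in> G"
        using rel_frontier_of_polyhedron[OF polyF] by blast
      then have "G \<in> \<G>"
        using T(1) F(1) face_of_trans[of G F T] aff_dim_mesh[OF T(1)]
        by (auto simp: \<G>_def facet_of_def intro!: bexI[of _ T])
      then show False
        using p(3) G(2) by blast
    qed
    have "F \<subseteq> frontier (\<Union>\<T>)"
    proof (rule ccontr)
      assume "\<not> F \<subseteq> frontier (\<Union>\<T>)"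
      then obtain y where y: "y \<in> F" "y \<in> interior (\<Union>\<T>)"
        using F(1) T(1) facet_of_imp_subset closure_subset unfolding frontier_def by blast
      have "y \<in> closure (rel_interior F)"
        using y(1) convex_closure_rel_interior[OF polyhedron_imp_convex[OF polyF]]
          closure_subset by auto
      \<comment> \<open>The relative interior is dense in \<open>F\<close>, so it meets the open
        interior of the mesh as soon as \<open>F\<close> does.\<close>
      then have "rel_interior F \<inter> interior (\<Union>\<T>) \<noteq> {}"
        using y(2) by (metis IntI Int_commute empty_iff open_Int_closure_eq_empty open_interior)
      then have "p \<in> interior (\<Union>\<T>)"
        using rel_interior_facet_interior[OF T(1) F(1) _ _ pF] by blast
      then show False
        using p(1) by (simp add: frontier_def)
    qed
    then have "F \<in> ?B"
      using F T by blast
    then show False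
      using r(2) p(2) F(2) by blast
  qed
qed blast

end

text \<open>Below the Lipschitz graph there is an open set free of the domain. A frontier point
  interior to the closure could be pushed down into that set while staying in the closure, which is
  impossible; this rules out slits.\<close>

lemma frontier_closure_lipschitz:
  fixes \<Omega> :: "'a::euclidean_space set"
  assumes "open \<Omega>" "lipschitz_boundary \<Omega>"
  shows "frontier (closure \<Omega>) = frontier \<Omega>"
proof -
  have "x \<notin> interior (closure \<Omega>)" if x: "x \<in> frontier \<Omega>" for x
  proof
    assume int: "x \<in> interior (closure \<Omega>)"
    obtain r e L and \<phi> :: "'a \<Rightarrow> real" where r: "r > 0" and e: "norm e = 1"
      and lip: "L-lipschitz_on UNIV \<phi>"
      and eq: "\<Omega> \<inter> ball x r = {y \<in> ball x r. \<phi> (y - (y \<bullet> e) *\<^sub>R e) < y \<bullet> e}"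
      using bspec[OF assms(2)[unfolded lipschitz_boundary_def] x] by blast
    define h where "h y = y \<bullet> e - \<phi> (y - (y \<bullet> e) *\<^sub>R e)" for y
    have "continuous_on UNIV \<phi>"
      using lip lipschitz_on_continuous_on by blast
    then have "continuous_on UNIV (\<lambda>y. \<phi> (y - (y \<bullet> e) *\<^sub>R e))"
      by (rule continuous_on_compose2) (auto intro!: continuous_intros)
    then have cont: "continuous_on UNIV h"
      unfolding h_def by (intro continuous_on_diff continuous_on_inner continuous_on_id continuous_on_const)
    have "x \<notin> \<Omega>"
      using x assms(1) by (simp add: frontier_def interior_open)
    then have "h x \<le> 0"
      using eq r by (force simp: h_def)
    have ee: "e \<bullet> e = 1"
      using e by (simp add: norm_eq_1)
    obtain s where s: "s > 0" "s < r" "x - s *\<^sub>R e \<in> closure \<Omega>"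
    proof -
      obtain d where d: "d > 0" "ball x d \<subseteq> closure \<Omega>"
        using int mem_interior by blast
      define s where "s = min d r / 2"
      have "x - s *\<^sub>R e \<in> ball x d"
        using d r e by (simp add: s_def dist_norm)
      then show thesis
        using that[of s] d r unfolding s_def by force
    qed
    \<comment> \<open>Translation along \<open>e\<close> does not change the component orthogonal to
      \<open>e\<close>, so the height \<open>h\<close> above the graph drops by exactly
      \<open>s\<close>.\<close>
    have "h (x - s *\<^sub>R e) = h x - s"
      by (simp add: h_def inner_diff_left ee algebra_simps)
    then have neg: "h (x - s *\<^sub>R e) < 0"
      using \<open>h x \<le> 0\<close> s by simp
    define W where "W = ball x r \<inter> {y. h y < 0}"
    have "open W"
      unfolding W_def using open_Collect_less[OF cont continuous_on_const] by blast
    moreover have "x - s *\<^sub>R e \<in> W"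
      using neg s e by (simp add: W_def dist_norm)
    ultimately have "W \<inter> \<Omega> \<noteq> {}"
      using s(3) by (metis IntI empty_iff open_Int_closure_eq_empty)
    then show False
      using eq unfolding W_def h_def by force
  qed
  moreover have "\<Omega> \<subseteq> interior (closure \<Omega>)"
    using assms(1) closure_subset interior_maximal by blast
  ultimately show ?thesis
    using assms(1) unfolding frontier_def by (auto simp: interior_open)
qed

section \<open>Nodal interpolation on a boundary part\<close>

text \<open>Translating one point \<open>v0\<close> to the origin makes the others linearly
  independent, so a linear functional with the required differences exists;
  \<open>adjoint l 1\<close> is the vector representing it.\<close>

lemma affine_independent_affine_extension:
  fixes V :: "'a::euclidean_space set" and \<phi> :: "'a \<Rightarrow> real"
  assumes "\<not> affine_dependent V"
  obtains a c where "\<And>v. v \<in> V \<Longrightarrow> a \<bullet> v + c = \<phi> v"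
proof (cases "V = {}")
  case False
  then obtain v0 where v0: "v0 \<in> V"
    by blast
  have "\<not> affine_dependent (insert v0 (V - {v0}))"
    using assms v0 by (simp add: insert_absorb)
  then have "independent ((\<lambda>x. - v0 + x) ` (V - {v0}))"
    using affine_dependent_iff_dependent[of v0 "V - {v0}"] by simp
  then obtain l where l: "linear l"
    "\<forall>x \<in> (\<lambda>x. - v0 + x) ` (V - {v0}). l x = \<phi> (v0 + x) - \<phi> v0"
    using linear_independent_extend[of _ "\<lambda>x. \<phi> (v0 + x) - \<phi> v0"] by blast
  define a where "a = adjoint l 1"
  have a: "a \<bullet> x = l x" for x
    using adjoint_works[OF l(1), of x 1] by (simp add: a_def inner_commute)
  have "a \<bullet> v + (\<phi> v0 - a \<bullet> v0) = \<phi> v" if "v \<in> V" for v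
  proof (cases "v = v0")
    case False
    then have "l (- v0 + v) = \<phi> v - \<phi> v0"
      using l(2) that by force
    then show ?thesis
      by (simp add: a[symmetric] inner_diff_right)
  qed simp
  then show thesis
    by (rule that)
qed (use that in blast)

lemma affine_nonneg_convex_hull:
  fixes a :: "'a::euclidean_space"
  assumes "\<And>v. v \<in> V \<Longrightarrow> a \<bullet> v + c \<ge> 0" "x \<in> convex hull V"
  shows "a \<bullet> x + c \<ge> 0"
proof -
  have "convex hull V \<subseteq> {x. a \<bullet> x \<ge> - c}"
    using assms(1) by (intro hull_minimal convex_halfspace_ge) force
  then show ?thesis
    using assms(2) by force
qed

text \<open>The form \<open>v x + t * w x\<close> covers sums, differences and multiples at once and
  is also the variation inserted into the energy later.\<close>

lemma affine_fun_on_add_scaled: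
  assumes "affine_fun_on S v" "affine_fun_on S w"
  shows "affine_fun_on S (\<lambda>x. v x + t * w x)"
proof -
  obtain a c a' c' where "\<forall>x\<in>S. v x = a \<bullet> x + c" "\<forall>x\<in>S. w x = a' \<bullet> x + c'"
    using assms by (auto simp: affine_fun_on_def)
  then have "\<forall>x\<in>S. v x + t * w x = (a + t *\<^sub>R a') \<bullet> x + (c + t * c')"
    by (simp add: inner_add_left algebra_simps)
  then show ?thesis
    unfolding affine_fun_on_def by blast
qed

lemma affine_fun_on_const: "affine_fun_on S (\<lambda>x. c)"
  unfolding affine_fun_on_def by (intro exI[of _ 0] exI[of _ c]) simp

lemma S1_add_scaled:
  assumes "v \<in> S1 \<Omega> \<T>" "w \<in> S1 \<Omega> \<T>"
  shows "(\<lambda>x. v x + t * w x) \<in> S1 \<Omega> \<T>"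
  using assms by (auto simp: S1_def intro!: continuous_intros affine_fun_on_add_scaled)

lemma S1_const: "(\<lambda>x. c) \<in> S1 \<Omega> \<T>"
  by (simp add: S1_def affine_fun_on_const)

lemma S1_bd_add_scaled:
  assumes "v \<in> S1_bd \<Omega> \<T> \<Gamma>" "w \<in> S1_bd \<Omega> \<T> \<Gamma>"
  shows "(\<lambda>x. v x + t * w x) \<in> S1_bd \<Omega> \<T> \<Gamma>"
  using assms by (auto simp: S1_bd_def intro!: continuous_intros affine_fun_on_add_scaled)

lemma S1_bd_const: "(\<lambda>x. c) \<in> S1_bd \<Omega> \<T> \<Gamma>"
  by (simp add: S1_bd_def affine_fun_on_const)

section \<open>Vertices of boundary facets\<close>

context simplicial_mesh
begin

lemma finite_mesh_nodes: "finite (mesh_nodes \<T>)"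
proof -
  have "mesh_nodes \<T> = (\<Union>T\<in>\<T>. {z. z extreme_point_of T})"
    by (auto simp: mesh_nodes_def)
  then show ?thesis
    using finite_mesh polyhedron_mesh finite_polyhedron_extreme_points by auto
qed

lemma finite_boundary_facets: "finite (boundary_facets \<Omega> \<T>)"
  by (rule finite_subset[of _ "\<Union>T\<in>\<T>. {F. F facet_of T}"])
    (use finite_mesh polytope_mesh finite_polytope_facets in \<open>auto simp: boundary_facets_def\<close>)

lemma boundary_facetE:
  assumes "F \<in> boundary_facets \<Omega> \<T>"
  obtains T where "T \<in> \<T>" "F facet_of T" "F \<subseteq> frontier \<Omega>"
  using assms by (auto simp: boundary_facets_def)

lemma polytope_boundary_facet:
  assumes "F \<in> boundary_facets \<Omega> \<T>"
  shows "polytope F"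
  using assms
  by (metis boundary_facetE face_of_polytope_polytope facet_of_imp_face_of polytope_mesh)

lemma Int_face_of_boundary_facets:
  assumes "F \<in> boundary_facets \<Omega> \<T>" "F' \<in> boundary_facets \<Omega> \<T>"
  shows "(F \<inter> F') face_of F"
proof -
  obtain T T' where T: "T \<in> \<T>" "F facet_of T" "T' \<in> \<T>" "F' facet_of T'"
    using assms by (meson boundary_facetE)
  have "(T \<inter> T') face_of T" "(T \<inter> T') face_of T'"
    using Int_face_of_mesh[OF T(1,3)] Int_face_of_mesh[OF T(3,1)] by (simp_all add: Int_commute)
  then show ?thesis
    using face_of_Int_subface T facet_of_imp_face_of by blast
qed

text \<open>A facet of a simplex is spanned by some of its vertices. Their inherited affine
  independence is what allows nodal values to be prescribed freely.\<close>

lemma boundary_facet_vertices: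
  assumes "F \<in> boundary_facets \<Omega> \<T>"
  obtains V where "\<not> affine_dependent V" "F = convex hull V" "V = {z. z extreme_point_of F}"
    "V \<subseteq> mesh_nodes \<T>"
proof -
  obtain T where T: "T \<in> \<T>" "F facet_of T"
    using assms by (meson boundary_facetE)
  obtain C where C: "\<not> affine_dependent C" "T = convex hull C"
    using simplex_mesh[OF T(1)] by (auto simp: simplex_def)
  obtain V where V: "V \<subseteq> C" "F = convex hull V"
    using T(2) face_of_convex_hull_affine_independent[OF C(1)] C(2) facet_of_imp_face_of by metis
  have indep: "\<not> affine_dependent V"
    using C(1) V(1) affine_independent_subset by blast
  have ext: "V = {z. z extreme_point_of F}"
    using extreme_point_of_convex_hull_affine_independent[OF indep] V(2) by auto
  then have "V \<subseteq> mesh_nodes \<T>"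
    using T facet_of_imp_face_of[OF T(2)] extreme_point_of_face by (fastforce simp: mesh_nodes_def)
  then show thesis
    using that indep V(2) ext by blast
qed

text \<open>There are no hanging nodes: \<open>{z}\<close> is a face of some element, by conformity
  also of the element carrying \<open>F\<close>, and thus of \<open>F\<close>. Otherwise an
  interpolant on \<open>F\<close> could be overdetermined.\<close>

lemma mesh_node_extreme_point:
  assumes "z \<in> mesh_nodes \<T>" "F \<in> boundary_facets \<Omega> \<T>" "z \<in> F"
  shows "z extreme_point_of F"
proof -
  obtain T where T: "T \<in> \<T>" "F facet_of T"
    using assms(2) by (meson boundary_facetE)
  obtain T' where T': "T' \<in> \<T>" "z extreme_point_of T'"
    using assms(1) by (auto simp: mesh_nodes_def)
  have "z \<in> T"
    using assms(3) facet_of_imp_subset[OF T(2)] by blast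
  then have "{z} face_of T"
    using face_of_other[OF T'(1) T(1), of "{z}"] T'(2) by (simp add: face_of_singleton)
  then have "{z} face_of F"
    using face_of_face[OF facet_of_imp_face_of[OF T(2)]] assms(3) by blast
  then show ?thesis
    by (simp add: face_of_singleton)
qed

end

text \<open>The geometric interface of a boundary part. \<open>closure_eq_facets\<close> lets nodal
  values determine functions on the part; \<open>rel_interior_meets\<close> and
  \<open>openin_part\<close> give it a relatively open piece of each of its facets.\<close>

locale boundary_part = simplicial_mesh \<T> for \<T> :: "'a::euclidean_space set set" +
  fixes \<Omega> \<Gamma> :: "'a set"
  assumes closure_eq_facets: "closure \<Gamma> = \<Union>(facets_on \<Omega> \<T> \<Gamma>)"
    and rel_interior_meets: "\<And>F. F \<in> facets_on \<Omega> \<T> \<Gamma> \<Longrightarrow> \<Gamma> \<inter> rel_interior F \<noteq> {}"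
    and openin_part: "openin (top_of_set (frontier \<Omega>)) \<Gamma>"
    and other_facets_disjoint:
      "\<And>F. F \<in> boundary_facets \<Omega> \<T> \<Longrightarrow> F \<notin> facets_on \<Omega> \<T> \<Gamma> \<Longrightarrow> F \<inter> \<Gamma> = {}"
begin

abbreviation nodes :: "'a set" where
  "nodes \<equiv> mesh_nodes \<T> \<inter> closure \<Gamma>"

abbreviation I_h :: "('a \<Rightarrow> real) \<Rightarrow> 'a \<Rightarrow> real" where
  "I_h \<equiv> nodal_interp \<Omega> \<T> \<Gamma>"

lemma finite_nodes: "finite nodes"
  using finite_mesh_nodes by blast

lemma facets_on_boundary: "F \<in> facets_on \<Omega> \<T> \<Gamma> \<Longrightarrow> F \<in> boundary_facets \<Omega> \<T>"
  by (simp add: facets_on_def)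

lemma finite_facets_on: "finite (facets_on \<Omega> \<T> \<Gamma>)"
  by (rule finite_subset[OF _ finite_boundary_facets]) (auto simp: facets_on_def)

lemma facet_vertices:
  assumes "F \<in> facets_on \<Omega> \<T> \<Gamma>"
  obtains V where "\<not> affine_dependent V" "F = convex hull V" "V = {z. z extreme_point_of F}"
    "V \<subseteq> nodes"
proof -
  obtain V where V: "\<not> affine_dependent V" "F = convex hull V" "V = {z. z extreme_point_of F}"
    "V \<subseteq> mesh_nodes \<T>"
    using boundary_facet_vertices[OF facets_on_boundary[OF assms]] by blast
  moreover have "V \<subseteq> closure \<Gamma>"
    using V(2) hull_subset[of V convex] assms by (auto simp: facets_on_def)
  ultimately show thesis
    using that by blast
qed

text \<open>On a facet the function is affine, hence controlled by its values at the vertices.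
  Applied to both differences of two functions, this yields uniqueness of interpolants.\<close>

lemma S1_bd_nonneg:
  assumes w: "w \<in> S1_bd \<Omega> \<T> \<Gamma>" "\<And>z. z \<in> nodes \<Longrightarrow> w z \<ge> 0" and x: "x \<in> closure \<Gamma>"
  shows "w x \<ge> 0"
proof -
  obtain F where F: "F \<in> facets_on \<Omega> \<T> \<Gamma>" "x \<in> F"
    using x closure_eq_facets by auto
  obtain V where V: "F = convex hull V" "V \<subseteq> nodes"
    using facet_vertices[OF F(1)] by metis
  obtain a c where ac: "\<And>y. y \<in> F \<Longrightarrow> w y = a \<bullet> y + c"
    using w(1) F(1) unfolding S1_bd_def affine_fun_on_def by blast
  have "a \<bullet> x + c \<ge> 0"
  proof (rule affine_nonneg_convex_hull)
    fix v assume "v \<in> V"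
    then show "a \<bullet> v + c \<ge> 0"
      using ac[of v] w(2)[of v] V hull_inc[of v V convex] by auto
  qed (use F V in simp)
  then show ?thesis
    using ac F by simp
qed

lemma S1_bd_eqI:
  assumes "w \<in> S1_bd \<Omega> \<T> \<Gamma>" "w' \<in> S1_bd \<Omega> \<T> \<Gamma>" "\<And>z. z \<in> nodes \<Longrightarrow> w z = w' z"
    and "x \<in> closure \<Gamma>"
  shows "w x = w' x"
proof -
  have "0 \<le> w x + (-1) * w' x"
    by (rule S1_bd_nonneg[OF S1_bd_add_scaled[OF assms(1,2)] _ assms(4)]) (simp add: assms(3))
  moreover have "0 \<le> w' x + (-1) * w x"
    by (rule S1_bd_nonneg[OF S1_bd_add_scaled[OF assms(2,1)] _ assms(4)]) (simp add: assms(3))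
  ultimately show ?thesis
    by simp
qed

text \<open>Each facet carries an affine function with the prescribed vertex values. Two of them
  agree where their facets meet, so they glue to a function that is continuous because the facets
  are finitely many closed sets.\<close>

lemma S1_bd_interpolant_exists:
  "\<exists>w \<in> S1_bd \<Omega> \<T> \<Gamma>. (\<forall>z\<in>nodes. w z = \<phi> z) \<and> (\<forall>x. x \<notin> closure \<Gamma> \<longrightarrow> w x = 0)"
proof -
  have "\<exists>a c. \<forall>z. z extreme_point_of F \<longrightarrow> a \<bullet> z + c = \<phi> z" if "F \<in> facets_on \<Omega> \<T> \<Gamma>" for F
    using facet_vertices[OF that] affine_independent_affine_extension
    by (metis mem_Collect_eq)
  then obtain a c where
    ac: "\<And>F z. F \<in> facets_on \<Omega> \<T> \<Gamma> \<Longrightarrow> z extreme_point_of F \<Longrightarrow> a F \<bullet> z + c F = \<phi> z"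
    by metis
  \<comment> \<open>The intersection is a common face, spanned by extreme points that are vertices
    of both facets. Both affine functions take the prescribed values there, and two opposite
    inequalities give equality on the hull.\<close>
  have consistent: "a F \<bullet> x + c F = a F' \<bullet> x + c F'"
    if F: "F \<in> facets_on \<Omega> \<T> \<Gamma>" "F' \<in> facets_on \<Omega> \<T> \<Gamma>" and x: "x \<in> F" "x \<in> F'" for F F' x
  proof -
    have face: "(F \<inter> F') face_of F" "(F \<inter> F') face_of F'"
      using Int_face_of_boundary_facets F facets_on_boundary by (metis Int_commute)+
    have "polytope (F \<inter> F')"
      using face_of_polytope_polytope[OF polytope_boundary_facet face(1)] F facets_on_boundary by blast
    then have "F \<inter> F' = convex hull {z. z extreme_point_of (F \<inter> F')}"
      by (intro Krein_Milman_Minkowski polytope_imp_compact polytope_imp_convex)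
    then have xh: "x \<in> convex hull {z. z extreme_point_of (F \<inter> F')}"
      using x by blast
    have eq: "a F \<bullet> z + c F = a F' \<bullet> z + c F'" if "z extreme_point_of (F \<inter> F')" for z
      using that face ac[OF F(1)] ac[OF F(2)] by (metis extreme_point_of_face)
    have "(a F - a F') \<bullet> x + (c F - c F') \<ge> 0"
      by (rule affine_nonneg_convex_hull[OF _ xh]) (auto simp: inner_diff_left dest: eq)
    moreover have "(a F' - a F) \<bullet> x + (c F' - c F) \<ge> 0"
      by (rule affine_nonneg_convex_hull[OF _ xh]) (auto simp: inner_diff_left dest: eq)
    ultimately show ?thesis
      by (simp add: inner_diff_left)
  qed
  \<comment> \<open>An arbitrary facet through \<open>x\<close>; consistency makes the choice
    irrelevant.\<close>
  define f where "f x = (SOME F. F \<in> facets_on \<Omega> \<T> \<Gamma> \<and> x \<in> F)" for x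
  define w where "w x = (if x \<in> closure \<Gamma> then a (f x) \<bullet> x + c (f x) else 0)" for x
  have w: "w x = a F \<bullet> x + c F" if "F \<in> facets_on \<Omega> \<T> \<Gamma>" "x \<in> F" for F x
  proof -
    have "f x \<in> facets_on \<Omega> \<T> \<Gamma> \<and> x \<in> f x"
      unfolding f_def by (rule someI[of _ F]) (use that in blast)
    moreover have "x \<in> closure \<Gamma>"
      using that closure_eq_facets by blast
    ultimately show ?thesis
      using consistent[of "f x" F x] that by (metis w_def)
  qed
  have "continuous_on (\<Union>F\<in>facets_on \<Omega> \<T> \<Gamma>. F) w"
  proof (rule continuous_on_closed_Union[OF finite_facets_on])
    show "continuous_on F w" if "F \<in> facets_on \<Omega> \<T> \<Gamma>" for F
    proof -
      have "continuous_on F (\<lambda>x. a F \<bullet> x + c F)"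
        by (intro continuous_intros)
      then show ?thesis
        using w[OF that] by (metis (no_types, lifting) continuous_on_cong)
    qed
  qed (use polytope_boundary_facet facets_on_boundary polytope_imp_closed in blast)
  then have "w \<in> S1_bd \<Omega> \<T> \<Gamma>"
    using w unfolding S1_bd_def affine_fun_on_def closure_eq_facets by fastforce
  moreover have "w z = \<phi> z" if z: "z \<in> nodes" for z
  proof -
    obtain F where F: "F \<in> facets_on \<Omega> \<T> \<Gamma>" "z \<in> F"
      using z closure_eq_facets by auto
    then show ?thesis
      using w[OF F] ac[OF F(1)] mesh_node_extreme_point[OF _ facets_on_boundary[OF F(1)]] z by simp
  qed
  ultimately show ?thesis
    by (intro bexI[of _ w]) (auto simp: w_def)
qed

lemma nodal_interp:
  shows nodal_interp_in_S1_bd: "I_h \<phi> \<in> S1_bd \<Omega> \<T> \<Gamma>"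
    and nodal_interp_node: "z \<in> nodes \<Longrightarrow> I_h \<phi> z = \<phi> z"
    and nodal_interp_outside: "x \<notin> closure \<Gamma> \<Longrightarrow> I_h \<phi> x = 0"
proof -
  let ?P = "\<lambda>w. w \<in> S1_bd \<Omega> \<T> \<Gamma> \<and> (\<forall>z\<in>nodes. w z = \<phi> z) \<and> (\<forall>x. x \<notin> closure \<Gamma> \<longrightarrow> w x = 0)"
  have "\<exists>!w. ?P w"
  proof (rule ex_ex1I)
    show "\<exists>w. ?P w"
      using S1_bd_interpolant_exists by blast
    show "w = w'" if "?P w" "?P w'" for w w'
    proof
      show "w x = w' x" for x
        using that S1_bd_eqI[of w w' x] by (cases "x \<in> closure \<Gamma>") auto
    qed
  qed
  then have "?P (I_h \<phi>)"
    unfolding nodal_interp_def by (rule theI')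
  then show "I_h \<phi> \<in> S1_bd \<Omega> \<T> \<Gamma>" "z \<in> nodes \<Longrightarrow> I_h \<phi> z = \<phi> z"
    "x \<notin> closure \<Gamma> \<Longrightarrow> I_h \<phi> x = 0"
    by blast+
qed

lemma nodal_interp_eqI:
  assumes "w \<in> S1_bd \<Omega> \<T> \<Gamma>" "\<And>z. z \<in> nodes \<Longrightarrow> w z = \<phi> z" "\<And>x. x \<notin> closure \<Gamma> \<Longrightarrow> w x = 0"
  shows "I_h \<phi> = w"
proof
  show "I_h \<phi> x = w x" for x
  proof (cases "x \<in> closure \<Gamma>")
    case True
    then show ?thesis
      by (rule S1_bd_eqI[OF nodal_interp_in_S1_bd assms(1), rotated])
        (use assms(2) in \<open>simp add: nodal_interp_node\<close>)
  qed (simp add: assms(3) nodal_interp_outside)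
qed

lemma nodal_interp_nonneg:
  assumes "\<And>z. z \<in> nodes \<Longrightarrow> \<phi> z \<ge> 0"
  shows "I_h \<phi> x \<ge> 0"
  using S1_bd_nonneg[OF nodal_interp_in_S1_bd, of \<phi> x] nodal_interp_outside[of x \<phi>] assms
  by (cases "x \<in> closure \<Gamma>") (simp_all add: nodal_interp_node)

definition hat :: "'a \<Rightarrow> 'a \<Rightarrow> real" where
  "hat z = I_h (\<lambda>x. if x = z then 1 else 0)"

lemma sum_S1_bd:
  assumes "finite A" "\<And>z. z \<in> A \<Longrightarrow> h z \<in> S1_bd \<Omega> \<T> \<Gamma>"
  shows "(\<lambda>x. \<Sum>z\<in>A. t z * h z x) \<in> S1_bd \<Omega> \<T> \<Gamma>"
  using assms
proof (induction A rule: finite_induct)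
  case (insert z A)
  have "(\<lambda>x. (\<Sum>z\<in>A. t z * h z x) + t z * h z x) \<in> S1_bd \<Omega> \<T> \<Gamma>"
    using insert by (intro S1_bd_add_scaled) auto
  then show ?case
    using insert by (simp add: add.commute)
qed (simp add: S1_bd_const)

lemma nodal_interp_eq_sum_hat: "I_h \<phi> x = (\<Sum>z\<in>nodes. \<phi> z * hat z x)"
proof -
  have "I_h \<phi> = (\<lambda>x. \<Sum>z\<in>nodes. \<phi> z * hat z x)"
  proof (rule nodal_interp_eqI)
    show "(\<lambda>x. \<Sum>z\<in>nodes. \<phi> z * hat z x) \<in> S1_bd \<Omega> \<T> \<Gamma>"
      using finite_nodes nodal_interp_in_S1_bd by (intro sum_S1_bd) (auto simp: hat_def)
    show "(\<Sum>z\<in>nodes. \<phi> z * hat z y) = \<phi> y" if "y \<in> nodes" for y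
    proof -
      have "(\<Sum>z\<in>nodes. \<phi> z * hat z y) = (\<Sum>z\<in>nodes. if y = z then \<phi> z else 0)"
        by (rule sum.cong) (use that in \<open>auto simp: hat_def nodal_interp_node\<close>)
      then show ?thesis
        using that finite_nodes by simp
    qed
  qed (simp add: hat_def nodal_interp_outside)
  then show ?thesis
    by simp
qed

lemma hat_nonneg: "hat z x \<ge> 0"
  unfolding hat_def by (rule nodal_interp_nonneg) simp

text \<open>The zero set of a nonnegative affine function on \<open>F\<close> is a face. If it met
  the relative interior it would be all of \<open>F\<close>, contradicting the value 1 at
  \<open>z\<close>.\<close>

lemma hat_pos_rel_interior:
  assumes F: "F \<in> facets_on \<Omega> \<T> \<Gamma>" "z \<in> F" "z \<in> nodes" and x: "x \<in> rel_interior F"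
  shows "hat z x > 0"
proof (rule ccontr)
  assume "\<not> hat z x > 0"
  then have x0: "hat z x = 0"
    using hat_nonneg[of z x] by simp
  obtain a c where ac: "\<And>y. y \<in> F \<Longrightarrow> hat z y = a \<bullet> y + c"
    using nodal_interp_in_S1_bd[of "\<lambda>x. if x = z then 1 else 0"] F(1)
    unfolding S1_bd_def affine_fun_on_def hat_def by blast
  have cF: "convex F"
    using F(1) facets_on_boundary polytope_boundary_facet polytope_imp_convex by blast
  have "(F \<inter> {y. (-a) \<bullet> y = c}) face_of F"
  proof (rule face_of_Int_supporting_hyperplane_le[OF cF])
    show "(- a) \<bullet> y \<le> c" if "y \<in> F" for y
      using ac[OF that] hat_nonneg[of z y] by simp
  qed
  moreover have "x \<in> F"
    using x rel_interior_subset by blast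
  then have "a \<bullet> x = - c"
    using ac[of x] x0 by simp
  then have "(F \<inter> {y. (-a) \<bullet> y = c}) \<inter> rel_interior F \<noteq> {}"
    using x \<open>x \<in> F\<close> by auto
  ultimately have "F \<subseteq> F \<inter> {y. (-a) \<bullet> y = c}"
    by (intro subset_of_face_of[OF _ subset_refl])
  then have "(-a) \<bullet> z = c"
    using F(2) by blast
  then have "a \<bullet> z + c = 0"
    by simp
  then have "hat z z = 0"
    using ac F(2) by simp
  moreover have "hat z z = 1"
    using F(3) by (simp add: hat_def nodal_interp_node)
  ultimately show False
    by simp
qed

end

section \<open>Boundary parts arising from the split of the frontier\<close>

lemma simplicial_mesh_triangulation_of:
  fixes \<Omega> :: "'a::euclidean_space set"
  assumes "triangulation_of \<Omega> \<T>"
  shows "simplicial_mesh \<T>"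
proof -
  have tri: "triangulation \<T>" and simp: "\<forall>T\<in>\<T>. int DIM('a) simplex T"
    using assms by (auto simp only: triangulation_of_def)
  show ?thesis
  proof (rule simplicial_mesh.intro)
    show "finite \<T>"
      using tri by (auto simp only: triangulation_def)
    show "int DIM('a) simplex T" if "T \<in> \<T>" for T
      using simp that by (rule bspec)
    show "(T \<inter> T') face_of T" if "T \<in> \<T>" "T' \<in> \<T>" for T T'
      using tri that unfolding triangulation_def by meson
  qed
qed

text \<open>The facets cover the whole frontier, and relative openness of \<open>\<Gamma>I\<close>
  keeps it away from all facets in the closure of \<open>\<Gamma>N\<close>, so
  \<open>\<Gamma>I\<close> is covered by its own facets.\<close>

lemma boundary_partI:
  fixes \<Omega> :: "'a::euclidean_space set"
  assumes mesh: "triangulation_of \<Omega> \<T>" and dom: "open \<Omega>" "lipschitz_boundary \<Omega>"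
    and split: "boundary_split \<Omega> \<Gamma>I \<Gamma>N" "facets_split \<Omega> \<T> \<Gamma>I \<Gamma>N"
  shows "boundary_part \<T> \<Omega> \<Gamma>I"
proof -
  interpret simplicial_mesh \<T>
    using mesh by (rule simplicial_mesh_triangulation_of)
  have UT: "\<Union>\<T> = closure \<Omega>"
    using mesh by (simp add: triangulation_of_def)
  have fr: "frontier \<Omega> = \<Union>(boundary_facets \<Omega> \<T>)"
    using frontier_eq_Union_facets frontier_closure_lipschitz[OF dom]
    unfolding UT boundary_facets_def by simp
  have sub: "\<Gamma>I \<subseteq> frontier \<Omega>" "\<Gamma>N \<subseteq> frontier \<Omega>"
    using split(1) by (auto simp: boundary_split_def dest: openin_imp_subset)
  obtain U where U: "open U" "\<Gamma>I = frontier \<Omega> \<inter> U"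
    using split(1) by (auto simp: boundary_split_def openin_open)
  \<comment> \<open>An open set that meets the closure of \<open>\<Gamma>N\<close> meets
    \<open>\<Gamma>N\<close> itself, which is disjoint from \<open>\<Gamma>I\<close>.\<close>
  have N: "F \<inter> \<Gamma>I = {}" if "F \<in> facets_on \<Omega> \<T> \<Gamma>N" for F
  proof (rule ccontr)
    assume "F \<inter> \<Gamma>I \<noteq> {}"
    then have "U \<inter> closure \<Gamma>N \<noteq> {}"
      using that U(2) by (auto simp: facets_on_def)
    then have "U \<inter> \<Gamma>N \<noteq> {}"
      using U(1) open_Int_closure_eq_empty by blast
    then show False
      using U(2) sub split(1) by (auto simp: boundary_split_def)
  qed
  have other: "F \<inter> \<Gamma>I = {}" if "F \<in> boundary_facets \<Omega> \<T>" "F \<notin> facets_on \<Omega> \<T> \<Gamma>I" for F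
    using that N split(2) by (auto simp: facets_split_def)
  show ?thesis
  proof
    show "openin (top_of_set (frontier \<Omega>)) \<Gamma>I"
      using split(1) unfolding boundary_split_def by (rule conjunct1)
    show "F \<inter> \<Gamma>I = {}" if "F \<in> boundary_facets \<Omega> \<T>" "F \<notin> facets_on \<Omega> \<T> \<Gamma>I" for F
      using that by (rule other)
    show "closure \<Gamma>I = \<Union>(facets_on \<Omega> \<T> \<Gamma>I)"
    proof
      have "\<forall>F\<in>facets_on \<Omega> \<T> \<Gamma>I. closed F"
        unfolding facets_on_def using polytope_imp_closed[OF polytope_boundary_facet] by blast
      moreover have "finite (facets_on \<Omega> \<T> \<Gamma>I)"
        by (rule finite_subset[OF _ finite_boundary_facets]) (auto simp: facets_on_def)
      ultimately have "closed (\<Union>(facets_on \<Omega> \<T> \<Gamma>I))"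
        by (intro closed_Union)
      moreover have "\<Gamma>I \<subseteq> \<Union>(facets_on \<Omega> \<T> \<Gamma>I)"
        using sub(1) fr other by blast
      ultimately show "closure \<Gamma>I \<subseteq> \<Union>(facets_on \<Omega> \<T> \<Gamma>I)"
        by (rule closure_minimal[rotated])
    qed (auto simp: facets_on_def)
    show "\<Gamma>I \<inter> rel_interior F \<noteq> {}" if F: "F \<in> facets_on \<Omega> \<T> \<Gamma>I" for F
    proof -
      have FB: "F \<in> boundary_facets \<Omega> \<T>"
        using F by (simp add: facets_on_def)
      then obtain T where T: "T \<in> \<T>" "F facet_of T"
        by (meson boundary_facetE)
      have "convex F"
        using FB polytope_boundary_facet polytope_imp_convex by blast
      moreover have "F \<noteq> {}"
        using T(2) by (simp add: facet_of_def)
      ultimately obtain p where p: "p \<in> rel_interior F"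
        using rel_interior_eq_empty by blast
      have pF: "p \<in> F"
        using p rel_interior_subset by blast
      \<comment> \<open>Inside \<open>W\<close> the frontier consists of points of \<open>F\<close>
        only. As a relative interior point of \<open>F\<close> belongs to no other boundary facet,
        \<open>W\<close> is a neighbourhood of \<open>p\<close>, and the points of
        \<open>\<Gamma>I\<close> close to \<open>p\<close> must lie in \<open>F\<close>.\<close>
      define W where "W = - \<Union>(boundary_facets \<Omega> \<T> - {F})"
      have "\<forall>F'\<in>boundary_facets \<Omega> \<T> - {F}. closed F'"
        using polytope_imp_closed[OF polytope_boundary_facet] by blast
      with finite_Diff[OF finite_boundary_facets] have "closed (\<Union>(boundary_facets \<Omega> \<T> - {F}))"
        by (rule closed_Union)
      then have W: "open W"
        unfolding W_def by (rule open_Compl)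
      have disj: "p \<notin> F'" if F': "F' \<in> boundary_facets \<Omega> \<T>" "F' \<noteq> F" for F'
      proof
        assume "p \<in> F'"
        obtain T' where T': "T' \<in> \<T>" "F' facet_of T'"
          using F' by (meson boundary_facetE)
        then have "F facet_of T'"
          using facet_meets_rel_interior[OF T(1) T'(1) T(2) p] \<open>p \<in> F'\<close> facet_of_imp_subset by blast
        then show False
          using facet_of_eqI[OF convex_mesh[OF T'(1)] _ T'(2) p \<open>p \<in> F'\<close>] F'(2) by blast
      qed
      obtain R where R: "open R" "rel_interior F = affine hull F \<inter> R"
        using openin_rel_interior[of F] by (auto simp: openin_open)
      have "p \<in> W \<inter> R"
        using disj p R(2) by (auto simp: W_def)
      moreover have "p \<in> closure \<Gamma>I"
        using pF F by (auto simp: facets_on_def)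
      ultimately have "(W \<inter> R) \<inter> \<Gamma>I \<noteq> {}"
        using W R(1) by (metis IntI empty_iff open_Int open_Int_closure_eq_empty)
      then obtain y where y: "y \<in> W" "y \<in> R" "y \<in> \<Gamma>I"
        by blast
      then have "y \<in> \<Union>(boundary_facets \<Omega> \<T>)"
        using sub(1) fr by blast
      with y(1) have "y \<in> F"
        unfolding W_def by blast
      then have "y \<in> rel_interior F"
        using y R(2) hull_inc by auto
      then show ?thesis
        using y by blast
    qed
  qed
qed

section \<open>Surface integrals and lumped weights\<close>

lemma dist_closest_point_eq_infdist:
  fixes S :: "'a::euclidean_space set"
  assumes "closed S" "S \<noteq> {}"
  shows "dist x (closest_point S x) = infdist x S"
  using setdist_closest_point[OF assms, of x] by (simp add: infdist_eq_setdist)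

lemma closest_point_affine_hull_measurable:
  fixes F :: "'a::euclidean_space set"
  assumes "F \<noteq> {}"
  shows "closest_point (affine hull F) \<in> borel_measurable borel"
  using assms
  by (intro borel_measurable_continuous_onI continuous_on_closest_point)
    (auto simp: affine_imp_convex closed_affine_hull)

lemma sets_hyperplane_measure [simp]: "sets (hyperplane_measure F) = sets borel"
  by (simp add: hyperplane_measure_def)

lemma space_hyperplane_measure [simp]: "space (hyperplane_measure F) = UNIV"
  by (simp add: hyperplane_measure_def)

lemma emeasure_hyperplane_measure:
  fixes F :: "'a::euclidean_space set"
  assumes "F \<noteq> {}" "A \<in> sets borel"
  shows "emeasure (hyperplane_measure F) A =
    emeasure lborel (closest_point (affine hull F) -` A \<inter> {x. infdist x (affine hull F) \<le> 1/2})"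
proof -
  let ?S = "{x. infdist x (affine hull F) \<le> 1/2}"
  have S: "?S \<in> sets lborel"
    by (intro borel_closed[THEN sets_lborel[THEN equalityD2, THEN subsetD]]
        closed_Collect_le continuous_intros)
  have "closest_point (affine hull F) \<in> restrict_space lborel ?S \<rightarrow>\<^sub>M borel"
    using closest_point_affine_hull_measurable[OF assms(1)] by (intro measurable_restrict_space1) simp
  then have "emeasure (hyperplane_measure F) A =
      emeasure (restrict_space lborel ?S) (closest_point (affine hull F) -` A \<inter> ?S)"
    using assms(2) by (simp add: hyperplane_measure_def emeasure_distr space_restrict_space)
  also have "\<dots> = emeasure lborel (closest_point (affine hull F) -` A \<inter> ?S)"
    using S by (intro emeasure_restrict_space) auto
  finally show ?thesis .
qed

text \<open>The slab reaches only distance 1/2 from the hyperplane, so the preimage of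
  \<open>A\<close> under the projection stays within distance 1/2 of \<open>A\<close> and is bounded
  too.\<close>

lemma emeasure_hyperplane_measure_bounded:
  fixes F :: "'a::euclidean_space set"
  assumes "F \<noteq> {}" "A \<in> sets borel" "bounded A"
  shows "emeasure (hyperplane_measure F) A < \<infinity>"
proof -
  let ?P = "closest_point (affine hull F) -` A \<inter> {x. infdist x (affine hull F) \<le> 1/2}"
  obtain B where B: "\<And>x. x \<in> A \<Longrightarrow> norm x \<le> B"
    using assms(3) bounded_iff by blast
  have "norm x \<le> B + 1/2" if "x \<in> ?P" for x
  proof -
    have "dist x (closest_point (affine hull F) x) \<le> 1/2"
      using that dist_closest_point_eq_infdist[of "affine hull F" x] assms(1)
      by (simp add: closed_affine_hull)
    moreover have "norm (closest_point (affine hull F) x) \<le> B"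
      using that B by blast
    ultimately show ?thesis
      using norm_triangle_sub[of x "closest_point (affine hull F) x"] by (simp add: dist_norm)
  qed
  then have "bounded ?P"
    by (auto simp: bounded_iff)
  then show ?thesis
    using emeasure_bounded_finite assms by (simp add: emeasure_hyperplane_measure)
qed

text \<open>The preimage of \<open>A\<close> in the slab contains the nonempty set \<open>W\<close>,
  which is open because it uses the ambient open set \<open>R\<close> and the strict inequality;
  nonempty open sets have positive Lebesgue measure.\<close>

lemma emeasure_hyperplane_measure_pos:
  fixes F :: "'a::euclidean_space set"
  assumes "openin (top_of_set (affine hull F)) A" "A \<noteq> {}" "A \<in> sets borel"
  shows "emeasure (hyperplane_measure F) A > 0"
proof -
  let ?H = "affine hull F"
  obtain y where y: "y \<in> A"
    using assms(2) by blast
  obtain R where R: "open R" "A = ?H \<inter> R"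
    using assms(1) by (auto simp: openin_open)
  have "?H \<noteq> {}"
    using y R(2) by blast
  then have F: "F \<noteq> {}"
    by simp
  define W where "W = closest_point ?H -` R \<inter> {x. infdist x ?H < 1/2}"
  have cont: "continuous_on UNIV (closest_point ?H)"
    using \<open>?H \<noteq> {}\<close> by (intro continuous_on_closest_point)
      (auto simp: affine_imp_convex closed_affine_hull)
  have "open W"
    unfolding W_def using cont R(1)
    by (intro open_Int open_vimage open_Collect_less continuous_intros)
  moreover have "y \<in> W"
    using y R(2) by (simp add: W_def closest_point_self)
  ultimately have "emeasure lborel W > 0"
    using open_not_negligible[of W] negligible_iff_emeasure0[of W]
    by (auto simp: zero_less_iff_neq_zero borel_open)
  also have "\<dots> \<le> emeasure lborel (closest_point ?H -` A \<inter> {x. infdist x ?H \<le> 1/2})"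
  proof (rule emeasure_mono)
    show "W \<subseteq> closest_point ?H -` A \<inter> {x. infdist x ?H \<le> 1/2}"
      using closest_point_in_set[of ?H] \<open>?H \<noteq> {}\<close> R(2) by (auto simp: W_def closed_affine_hull)
    have "closest_point ?H -` A \<in> sets borel"
      using measurable_sets[OF closest_point_affine_hull_measurable[OF F] assms(3)] by simp
    moreover have "{x. infdist x ?H \<le> 1/2} \<in> sets borel"
      by (intro borel_closed closed_Collect_le continuous_intros)
    ultimately show "closest_point ?H -` A \<inter> {x. infdist x ?H \<le> 1/2} \<in> sets lborel"
      by simp
  qed
  also have "\<dots> = emeasure (hyperplane_measure F) A"
    using emeasure_hyperplane_measure[OF F assms(3)] by simp
  finally show ?thesis .
qed

lemma set_integrable_hyperplane_measure:
  fixes F :: "'a::euclidean_space set" and f :: "'a \<Rightarrow> real"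
  assumes "F \<noteq> {}" "A \<in> sets borel" "A \<subseteq> C" "compact C" "continuous_on C f"
  shows "set_integrable (hyperplane_measure F) A f"
proof -
  obtain B where B: "\<And>x. x \<in> C \<Longrightarrow> norm (f x) \<le> B"
    using compact_imp_bounded[OF compact_continuous_image[OF assms(5,4)]] unfolding bounded_iff by blast
  show ?thesis
    unfolding set_integrable_def
  proof (rule integrableI_bounded_set[where B = B])
    show "A \<in> sets (hyperplane_measure F)"
      using assms(2) by simp
    have "(\<lambda>x. indicator A x *\<^sub>R f x) \<in> borel_measurable borel"
      using borel_measurable_continuous_on_indicator[OF assms(2)] assms(3,5) continuous_on_subset by blast
    then show "(\<lambda>x. indicator A x *\<^sub>R f x) \<in> borel_measurable (hyperplane_measure F)"
      by (simp add: measurable_cong_sets[OF sets_hyperplane_measure refl])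
    show "emeasure (hyperplane_measure F) A < \<infinity>"
      by (rule emeasure_hyperplane_measure_bounded[OF assms(1,2)
            bounded_subset[OF compact_imp_bounded[OF assms(4)] assms(3)]])
    show "AE x in hyperplane_measure F. x \<in> A \<longrightarrow> norm (indicator A x *\<^sub>R f x) \<le> B"
      using B assms(3) by auto
  qed simp
qed

section \<open>Linearity of domain and boundary integrals\<close>

locale polyhedral_mesh = simplicial_mesh \<T> for \<T> :: "'a::euclidean_space set set" +
  fixes \<Omega> :: "'a set"
  assumes open_domain: "open \<Omega>" and bounded_domain: "bounded \<Omega>"
    and Union_mesh: "\<Union>\<T> = closure \<Omega>"
begin

lemma set_integrable_boundary:
  fixes f :: "'a \<Rightarrow> real"
  assumes "openin (top_of_set (frontier \<Omega>)) \<Gamma>" "continuous_on (closure \<Gamma>) f"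
    and F: "F \<in> boundary_facets \<Omega> \<T>"
  shows "set_integrable (hyperplane_measure F) (F \<inter> \<Gamma>) f"
proof (rule set_integrable_hyperplane_measure)
  show "F \<noteq> {}"
    using F by (metis boundary_facetE facet_of_def)
  obtain U where U: "open U" "\<Gamma> = frontier \<Omega> \<inter> U"
    using assms(1) by (auto simp: openin_open)
  have "closed F"
    using F polytope_boundary_facet polytope_imp_closed by blast
  then show "F \<inter> \<Gamma> \<in> sets borel"
    unfolding U(2) using U(1) by (intro sets.Int borel_closed borel_open) auto
  show "F \<inter> \<Gamma> \<subseteq> closure \<Gamma>"
    using closure_subset by blast
  have "bounded \<Gamma>"
    using U(2) bounded_subset[OF bounded_closure[OF bounded_domain], of \<Gamma>]
    by (auto simp: frontier_def)
  then show "compact (closure \<Gamma>)"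
    by simp
qed (rule assms(2))

lemma surface_integral_add_scaled:
  assumes "openin (top_of_set (frontier \<Omega>)) \<Gamma>"
    and "continuous_on (closure \<Gamma>) f" "continuous_on (closure \<Gamma>) g"
  shows "surface_integral \<Omega> \<T> \<Gamma> (\<lambda>x. f x + t * g x) =
    surface_integral \<Omega> \<T> \<Gamma> f + t * surface_integral \<Omega> \<T> \<Gamma> g"
proof -
  have "(LINT x:F \<inter> \<Gamma>|hyperplane_measure F. f x + t * g x) =
      (LINT x:F \<inter> \<Gamma>|hyperplane_measure F. f x) + t * (LINT x:F \<inter> \<Gamma>|hyperplane_measure F. g x)"
    if "F \<in> boundary_facets \<Omega> \<T>" for F
    using set_integrable_boundary[OF assms(1,2) that] set_integrable_boundary[OF assms(1,3) that]
    by (subst set_integral_add) auto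
  then show ?thesis
    by (simp add: surface_integral_def sum.distrib sum_distrib_left)
qed

lemma ip_L2_add_scaled:
  assumes "f \<in> S1 \<Omega> \<T>" "v \<in> S1 \<Omega> \<T>" "w \<in> S1 \<Omega> \<T>"
  shows "ip_L2 \<Omega> f (\<lambda>x. v x + t * w x) = ip_L2 \<Omega> f v + t * ip_L2 \<Omega> f w"
proof -
  have int: "set_integrable lebesgue \<Omega> (\<lambda>x. f x * v x)" if "v \<in> S1 \<Omega> \<T>" for v
  proof -
    have "continuous_on (closure \<Omega>) (\<lambda>x. f x * v x)"
      using assms(1) that by (auto simp: S1_def intro: continuous_intros)
    moreover have "compact (closure \<Omega>)"
      using bounded_domain by simp
    ultimately have "set_integrable lborel (closure \<Omega>) (\<lambda>x. f x * v x)"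
      unfolding set_integrable_def by (intro borel_integrable_compact) auto
    then have "set_integrable lborel \<Omega> (\<lambda>x. f x * v x)"
      by (rule set_integrable_subset) (use open_domain closure_subset in auto)
    then show ?thesis
      unfolding set_integrable_def using borel_measurable_integrable integrable_completion by blast
  qed
  have "ip_L2 \<Omega> f (\<lambda>x. v x + t * w x) = (LINT x:\<Omega>|lebesgue. f x * v x + t * (f x * w x))"
    by (simp add: ip_L2_def algebra_simps)
  also have "\<dots> = ip_L2 \<Omega> f v + t * ip_L2 \<Omega> f w"
    using int[OF assms(2)] int[OF assms(3)] by (subst set_integral_add) (auto simp: ip_L2_def)
  finally show ?thesis .
qed

lemma grad_interior:
  assumes "T \<in> \<T>" "x \<in> interior T" "\<And>y. y \<in> T \<Longrightarrow> v y = a \<bullet> y + c"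
  shows "grad v x = a"
proof -
  have "((\<lambda>y. a \<bullet> y + c) has_derivative (\<lambda>h. a \<bullet> h)) (at x)"
    by (auto intro!: derivative_eq_intros)
  then have "(v has_derivative (\<lambda>h. a \<bullet> h)) (at x)"
    by (rule has_derivative_transform_within_open[OF _ open_interior assms(2)])
      (use assms(3) interior_subset in \<open>metis subsetD\<close>)
  then have "frechet_derivative v (at x) = (\<lambda>h. a \<bullet> h)"
    using frechet_derivative_at by metis
  then show ?thesis
    by (simp add: grad_def euclidean_representation)
qed

text \<open>The points of the domain at which a function of \<open>S1\<close> need not be
  differentiable, so that \<open>grad\<close> carries no information there.\<close>

abbreviation skeleton :: "'a set" where
  "skeleton \<equiv> \<Omega> - (\<Union>T\<in>\<T>. interior T)"

lemma negligible_skeleton: "negligible skeleton"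
proof (rule negligible_subset)
  show "negligible (\<Union>T\<in>\<T>. frontier T)"
    using finite_mesh convex_mesh negligible_convex_frontier by (intro negligible_Union) auto
  show "skeleton \<subseteq> (\<Union>T\<in>\<T>. frontier T)"
  proof
    fix x assume x: "x \<in> skeleton"
    then have "x \<in> closure \<Omega>"
      using closure_subset[of \<Omega>] by blast
    then obtain T where "T \<in> \<T>" "x \<in> T"
      unfolding Union_mesh[symmetric] by blast
    then show "x \<in> (\<Union>T\<in>\<T>. frontier T)"
      using x closure_subset[of T] unfolding frontier_def by blast
  qed
qed

lemma S1_affineE:
  assumes "v \<in> S1 \<Omega> \<T>" "T \<in> \<T>"
  obtains a c where "\<And>y. y \<in> T \<Longrightarrow> v y = a \<bullet> y + c"
  using assms unfolding S1_def affine_fun_on_def by blast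

lemma grad_add_scaled:
  assumes "v \<in> S1 \<Omega> \<T>" "w \<in> S1 \<Omega> \<T>" "x \<in> \<Omega> - skeleton"
  shows "grad (\<lambda>x. v x + t * w x) x = grad v x + t *\<^sub>R grad w x"
proof -
  obtain T where T: "T \<in> \<T>" "x \<in> interior T"
    using assms(3) by blast
  obtain a c where v: "\<And>y. y \<in> T \<Longrightarrow> v y = a \<bullet> y + c"
    using S1_affineE[OF assms(1) T(1)] by blast
  obtain a' c' where w: "\<And>y. y \<in> T \<Longrightarrow> w y = a' \<bullet> y + c'"
    using S1_affineE[OF assms(2) T(1)] by blast
  have "grad (\<lambda>x. v x + t * w x) x = a + t *\<^sub>R a'"
    by (rule grad_interior[OF T, of _ _ "c + t * c'"])
      (simp add: v w inner_add_left algebra_simps)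
  moreover have "grad v x = a" "grad w x = a'"
    using grad_interior[OF T] v w by blast+
  ultimately show ?thesis
    by simp
qed

text \<open>The integrand is constant on every open element, and these finitely many sets exhaust
  the domain up to a negligible set.\<close>

lemma set_integrable_grad:
  assumes "v \<in> S1 \<Omega> \<T>" "w \<in> S1 \<Omega> \<T>"
  shows "set_integrable lebesgue \<Omega> (\<lambda>x. grad v x \<bullet> grad w x)"
proof -
  have "set_integrable lebesgue (\<Omega> \<inter> interior T) (\<lambda>x. grad v x \<bullet> grad w x)" if T: "T \<in> \<T>" for T
  proof -
    obtain a c where v: "\<And>y. y \<in> T \<Longrightarrow> v y = a \<bullet> y + c"
      using S1_affineE[OF assms(1) T] by blast
    obtain a' c' where w: "\<And>y. y \<in> T \<Longrightarrow> w y = a' \<bullet> y + c'"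
      using S1_affineE[OF assms(2) T] by blast
    have "\<Omega> \<inter> interior T \<in> lmeasurable"
      using open_domain bounded_domain by (intro lmeasurable_open) auto
    then have "set_integrable lebesgue (\<Omega> \<inter> interior T) (\<lambda>x. a \<bullet> a')"
      by (rule absolutely_integrable_on_const)
    moreover have "grad v x \<bullet> grad w x = a \<bullet> a'" if "x \<in> \<Omega> \<inter> interior T" for x
      using grad_interior[OF T _ v] grad_interior[OF T _ w] that by simp
    ultimately show ?thesis
      using set_integrable_cong[OF refl refl, of "\<Omega> \<inter> interior T"] by (metis (no_types, lifting))
  qed
  moreover have "\<Omega> \<inter> interior T \<in> sets lebesgue" for T
    using open_domain bounded_domain by (intro fmeasurableD lmeasurable_open) auto
  ultimately have "set_integrable lebesgue (\<Union>T\<in>\<T>. \<Omega> \<inter> interior T) (\<lambda>x. grad v x \<bullet> grad w x)"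
    using finite_mesh by (intro set_integrable_UN) auto
  then show ?thesis
    by (rule absolutely_integrable_spike_set)
      (auto intro!: negligible_subset[OF negligible_skeleton])
qed

lemma ip_L2_grad_add_scaled:
  assumes "u \<in> S1 \<Omega> \<T>" "v \<in> S1 \<Omega> \<T>" "w \<in> S1 \<Omega> \<T>"
  shows "ip_L2 \<Omega> (grad u) (grad (\<lambda>x. v x + t * w x)) =
    ip_L2 \<Omega> (grad u) (grad v) + t * ip_L2 \<Omega> (grad u) (grad w)"
proof -
  note int = set_integrable_grad[OF assms(1,2)] set_integrable_grad[OF assms(1,3)]
  have int': "set_integrable lebesgue \<Omega> (\<lambda>x. grad u x \<bullet> grad v x + t * (grad u x \<bullet> grad w x))"
    using int by auto
  \<comment> \<open>Additivity of \<open>grad\<close> holds only off the skeleton. The detour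
    through \<open>integral\<close> permits changing the integrand on that negligible set.\<close>
  have "ip_L2 \<Omega> (grad u) (grad (\<lambda>x. v x + t * w x)) =
      integral \<Omega> (\<lambda>x. grad u x \<bullet> grad (\<lambda>x. v x + t * w x) x)"
    unfolding ip_L2_def
    by (intro set_lebesgue_integral_eq_integral set_integrable_grad S1_add_scaled assms)
  also have "\<dots> = integral \<Omega> (\<lambda>x. grad u x \<bullet> grad v x + t * (grad u x \<bullet> grad w x))"
    by (rule integral_spike[OF negligible_skeleton])
      (use grad_add_scaled[OF assms(2,3)] in \<open>simp add: inner_add_right\<close>)
  also have "\<dots> = (LINT x:\<Omega>|lebesgue. grad u x \<bullet> grad v x + t * (grad u x \<bullet> grad w x))"
    using set_lebesgue_integral_eq_integral(2)[OF int'] by simp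
  also have "\<dots> = ip_L2 \<Omega> (grad u) (grad v) + t * ip_L2 \<Omega> (grad u) (grad w)"
    using int by (subst set_integral_add) (auto simp: ip_L2_def)
  finally show ?thesis .
qed

end

lemma ip_L2_commute: "ip_L2 \<Omega> v w = ip_L2 \<Omega> w v"
  by (simp add: ip_L2_def inner_commute)

lemma ip_L2_self_nonneg: "ip_L2 \<Omega> v v \<ge> 0"
  unfolding ip_L2_def set_lebesgue_integral_def by (intro integral_nonneg_AE) auto

lemma grad_const: "grad (\<lambda>x. c) = (\<lambda>x. 0)"
  by (rule ext) (simp add: grad_def)

section \<open>Lumped quadrature with positive weights\<close>

locale boundary_part_mesh = boundary_part \<T> \<Omega> \<Gamma> + polyhedral_mesh \<T> \<Omega>
  for \<T> :: "'a::euclidean_space set set" and \<Omega> \<Gamma> :: "'a set"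
begin

definition weight :: "'a \<Rightarrow> real" where
  "weight z = surface_integral \<Omega> \<T> \<Gamma> (hat z)"

lemma continuous_on_hat: "continuous_on (closure \<Gamma>) (hat z)"
  using nodal_interp_in_S1_bd unfolding hat_def S1_bd_def by blast

lemma surface_integral_nodal_interp:
  "surface_integral \<Omega> \<T> \<Gamma> (I_h \<phi>) = (\<Sum>z\<in>nodes. weight z * \<phi> z)"
proof -
  have "surface_integral \<Omega> \<T> \<Gamma> (\<lambda>x. \<Sum>z\<in>A. \<phi> z * hat z x) = (\<Sum>z\<in>A. weight z * \<phi> z)"
    if "finite A" for A
    using that
  proof (induction A rule: finite_induct)
    case empty
    then show ?case
      by (simp add: surface_integral_def set_lebesgue_integral_def)
  next
    case (insert z A)
    have "surface_integral \<Omega> \<T> \<Gamma> (\<lambda>x. (\<Sum>z\<in>A. \<phi> z * hat z x) + \<phi> z * hat z x) =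
        surface_integral \<Omega> \<T> \<Gamma> (\<lambda>x. \<Sum>z\<in>A. \<phi> z * hat z x) + \<phi> z * weight z"
      unfolding weight_def
      by (intro surface_integral_add_scaled openin_part continuous_on_hat continuous_intros)
    then show ?case
      using insert by (simp add: algebra_simps)
  qed
  moreover have "I_h \<phi> = (\<lambda>x. \<Sum>z\<in>nodes. \<phi> z * hat z x)"
    using nodal_interp_eq_sum_hat by blast
  ultimately show ?thesis
    using finite_nodes by simp
qed

text \<open>All facets contribute nonnegatively, and on a facet through \<open>z\<close> the hat
  function is positive throughout the relative interior, a piece of which belongs to
  \<open>\<Gamma>\<close>. A vanishing contribution would make that piece a null set.\<close>

lemma weight_pos:
  assumes z: "z \<in> nodes"
  shows "weight z > 0"
proof -
  obtain F where F: "F \<in> facets_on \<Omega> \<T> \<Gamma>" "z \<in> F"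
    using z closure_eq_facets by auto
  note FB = facets_on_boundary[OF F(1)]
  let ?I = "\<lambda>F. LINT x:F \<inter> \<Gamma>|hyperplane_measure F. hat z x"
  have nonneg: "?I G \<ge> 0" for G
    unfolding set_lebesgue_integral_def by (intro integral_nonneg_AE) (auto simp: hat_nonneg)
  have "?I F \<noteq> 0"
  proof
    assume "?I F = 0"
    then have AE: "AE x in hyperplane_measure F. indicator (F \<inter> \<Gamma>) x *\<^sub>R hat z x = 0"
      using set_integrable_boundary[OF openin_part continuous_on_hat FB, of z]
      unfolding set_lebesgue_integral_def set_integrable_def
      by (subst (asm) integral_nonneg_eq_0_iff_AE) (auto simp: hat_nonneg)
    obtain U where U: "open U" "\<Gamma> = frontier \<Omega> \<inter> U"
      using openin_part by (auto simp: openin_open)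
    \<comment> \<open>Since \<open>F\<close> lies in the frontier, relative openness of
      \<open>\<Gamma>\<close> there becomes relative openness of \<open>A\<close> in the affine hull
      of \<open>F\<close>, where open sets have positive measure.\<close>
    define A where "A = \<Gamma> \<inter> rel_interior F"
    have "rel_interior F \<subseteq> frontier \<Omega>"
      using FB rel_interior_subset by (fastforce simp: boundary_facets_def)
    then have A: "A = rel_interior F \<inter> U"
      unfolding A_def U(2) by blast
    then have opA: "openin (top_of_set (affine hull F)) A"
      using openin_Int_open[OF openin_rel_interior U(1)] by simp
    then obtain R where "open R" "A = affine hull F \<inter> R"
      by (auto simp: openin_open)
    then have mA: "A \<in> sets borel"
      by (auto intro!: sets.Int borel_open borel_closed closed_affine_hull)
    have "emeasure (hyperplane_measure F) A = 0"
    proof -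
      have "AE x in hyperplane_measure F. x \<notin> A"
        using AE
      proof eventually_elim
        case (elim x)
        then show ?case
          using hat_pos_rel_interior[OF F z, of x] rel_interior_subset[of F]
          by (auto simp: A_def indicator_def split: if_splits)
      qed
      then show ?thesis
        using mA AE_iff_measurable[of A "hyperplane_measure F" "\<lambda>x. x \<notin> A"] by simp
    qed
    moreover have "A \<noteq> {}"
      using rel_interior_meets[OF F(1)] A_def by blast
    ultimately show False
      using emeasure_hyperplane_measure_pos[OF opA _ mA] by simp
  qed
  then have "?I F > 0"
    using nonneg[of F] by simp
  also have "?I F \<le> weight z"
    unfolding weight_def surface_integral_def
    by (rule member_le_sum) (use FB nonneg finite_boundary_facets in auto)
  finally show ?thesis .
qed

lemma ip_lumped_eq_sum: "ip_lumped \<Omega> \<T> \<Gamma> v w = (\<Sum>z\<in>nodes. weight z * (v z * w z))"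
  by (simp add: ip_lumped_def ip_bd_def surface_integral_nodal_interp)

text \<open>Squaring undoes the root because positive weights make the lumped product of
  \<open>v\<close> with itself nonnegative.\<close>

lemma norm_lumped_power2: "(norm_lumped \<Omega> \<T> \<Gamma> v)\<^sup>2 = (\<Sum>z\<in>nodes. weight z * (v z)\<^sup>2)"
proof -
  have "ip_lumped \<Omega> \<T> \<Gamma> v v \<ge> 0"
    unfolding ip_lumped_eq_sum using weight_pos
    by (intro sum_nonneg mult_nonneg_nonneg[OF less_imp_le] zero_le_square)
  then show ?thesis
    by (simp add: norm_lumped_def ip_lumped_eq_sum power2_eq_square)
qed

lemma norm_L1_bd_nodal_interp:
  assumes "\<And>z. z \<in> nodes \<Longrightarrow> \<phi> z \<ge> 0"
  shows "norm_L1_bd \<Omega> \<T> \<Gamma> (I_h \<phi>) = (\<Sum>z\<in>nodes. weight z * \<phi> z)"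
proof -
  have "I_h \<phi> x \<ge> 0" for x
    by (rule nodal_interp_nonneg) (rule assms)
  then have "(\<lambda>x. \<bar>I_h \<phi> x\<bar>) = I_h \<phi>"
    by (intro ext abs_of_nonneg)
  then show ?thesis
    by (simp only: norm_L1_bd_def surface_integral_nodal_interp)
qed

end

section \<open>Minimality and optimality conditions\<close>

(* The tangent plane of the jointly convex function (a, s) |-> a^2 / s at (a, s). *)
lemma quotient_square_tangent:
  fixes a a' s s' :: real
  assumes "s > 0" "s' > 0"
  shows "a\<^sup>2 / s + 2 * (a / s) * (a' - a) - (a / s)\<^sup>2 * (s' - s) \<le> a'\<^sup>2 / s'"
proof -
  have "a'\<^sup>2 / s' - (a\<^sup>2 / s + 2 * (a / s) * (a' - a) - (a / s)\<^sup>2 * (s' - s)) = (a' - (a / s) * s')\<^sup>2 / s'"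
    using assms by (simp add: divide_simps power2_eq_square) (simp add: algebra_simps)
  moreover have "\<dots> \<ge> 0"
    using assms by simp
  ultimately show ?thesis
    by linarith
qed

text \<open>Complementarity of the thresholded distribution: for
  \<open>\<bar>a\<bar> \<le> C\<close> one has \<open>d = 0\<close> and the quotient is
  \<open>a\<close> itself; otherwise \<open>1 + \<beta> * d = \<bar>a\<bar> / C\<close> and the
  quotient has modulus \<open>C\<close>.\<close>

lemma pos_part_threshold:
  fixes a C \<beta> :: real
  assumes "\<beta> > 0" "C > 0" "d = 1 / (\<beta> * C) * pos_part (\<bar>a\<bar> - C)"
  shows "(a / (1 + \<beta> * d))\<^sup>2 \<le> C\<^sup>2" "d * (a / (1 + \<beta> * d))\<^sup>2 = d * C\<^sup>2"
proof -
  have "(a / (1 + \<beta> * d))\<^sup>2 \<le> C\<^sup>2 \<and> d * (a / (1 + \<beta> * d))\<^sup>2 = d * C\<^sup>2"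
  proof (cases "\<bar>a\<bar> \<le> C")
    case True
    then have "d = 0"
      using assms by (simp add: pos_part_def)
    then show ?thesis
      using True assms(2) by (simp add: abs_le_square_iff[symmetric])
  next
    case False
    then have "1 + \<beta> * d = \<bar>a\<bar> / C"
      using assms by (simp add: pos_part_def max_def field_simps)
    moreover have "a \<noteq> 0"
      using False assms(2) by auto
    ultimately have "(a / (1 + \<beta> * d))\<^sup>2 = C\<^sup>2"
      by (simp add: power_divide power_mult_distrib)
    then show ?thesis
      by simp
  qed
  then show "(a / (1 + \<beta> * d))\<^sup>2 \<le> C\<^sup>2" "d * (a / (1 + \<beta> * d))\<^sup>2 = d * C\<^sup>2"
    by blast+
qed

lemma quadratic_nonneg_imp_linear_zero:
  fixes A B :: real
  assumes "\<And>t. t * A + t\<^sup>2 * B \<ge> 0"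
  shows "A = 0"
proof (rule ccontr)
  assume "A \<noteq> 0"
  \<comment> \<open>Any positive \<open>D\<close> above \<open>B\<close> works: at
    \<open>t = - A / D\<close> the quadratic takes the value
    \<open>A\<^sup>2 * (B - D) / D\<^sup>2\<close>, negative unless \<open>A = 0\<close>.\<close>
  define D where "D = \<bar>B\<bar> + 1"
  have D: "D > 0" "B < D"
    by (auto simp: D_def)
  have "(- A / D) * A + (- A / D)\<^sup>2 * B = A\<^sup>2 * (B - D) / D\<^sup>2"
    using D by (simp add: divide_simps power2_eq_square) (simp add: algebra_simps)
  moreover have "A\<^sup>2 * (B - D) / D\<^sup>2 < 0"
    using D \<open>A \<noteq> 0\<close> by (intro divide_neg_pos mult_pos_neg) auto
  ultimately show False
    using assms[of "- A / D"] by linarith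
qed

(* Moving the mass t from z to y must not decrease the sum; divide by \<beta> t and let t tend to 0. *)
lemma mass_shift_inequality:
  fixes w a \<delta> :: "'n \<Rightarrow> real"
  assumes fin: "finite N" and w: "\<And>x. x \<in> N \<Longrightarrow> w x > 0" and \<beta>: "\<beta> > 0"
    and \<delta>: "\<And>x. x \<in> N \<Longrightarrow> \<delta> x \<ge> 0"
    and min: "\<And>\<eta>. (\<And>x. x \<in> N \<Longrightarrow> \<eta> x \<ge> 0) \<Longrightarrow> (\<Sum>x\<in>N. w x * \<eta> x) = (\<Sum>x\<in>N. w x * \<delta> x) \<Longrightarrow>
      (\<Sum>x\<in>N. w x * ((a x)\<^sup>2 / (1 + \<beta> * \<delta> x))) \<le> (\<Sum>x\<in>N. w x * ((a x)\<^sup>2 / (1 + \<beta> * \<eta> x)))"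
    and zy: "z \<in> N" "y \<in> N" "\<delta> z > 0"
  shows "(a y / (1 + \<beta> * \<delta> y))\<^sup>2 \<le> (a z / (1 + \<beta> * \<delta> z))\<^sup>2"
proof (cases "z = y")
  case False
  define s where "s x = 1 + \<beta> * \<delta> x" for x
  have s: "s x \<ge> 1" if "x \<in> N" for x
    using \<beta> \<delta>[OF that] by (simp add: s_def)
  \<comment> \<open>\<open>l\<close> and \<open>r\<close> are the decrease at \<open>y\<close> and
    the increase at \<open>z\<close> caused by moving the mass \<open>t\<close>, divided by
    \<open>\<beta> * t\<close>. The weights cancel, and in this form both are continuous at
    \<open>t = 0\<close>.\<close>
  define l where "l t = (a y)\<^sup>2 / (s y * (s y + \<beta> * (t / w y)))" for t
  define r where "r t = (a z)\<^sup>2 / (s z * (s z - \<beta> * (t / w z)))" for t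
  have split: "(\<Sum>x\<in>N. h x) = h z + (h y + (\<Sum>x\<in>N - {z} - {y}. h x))" for h :: "'n \<Rightarrow> real"
    using fin zy False by (simp add: sum.remove[of N z] sum.remove[of "N - {z}" y])
  have le: "l t \<le> r t" if t: "0 < t" "t < w z * \<delta> z" for t
  proof -
    \<comment> \<open>\<open>t\<close> is a mass, so nodal values change by \<open>t\<close> over
      the weight; the bound on \<open>t\<close> is the mass available at \<open>z\<close>.\<close>
    define \<eta> where "\<eta> = \<delta>(z := \<delta> z - t / w z, y := \<delta> y + t / w y)"
    have wz: "w z > 0" and wy: "w y > 0"
      using w zy by auto
    have tz: "t / w z < \<delta> z"
      using t wz by (simp add: field_simps)
    have rest: "(\<Sum>x\<in>N - {z} - {y}. h x (\<eta> x)) = (\<Sum>x\<in>N - {z} - {y}. h x (\<delta> x))"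
      for h :: "'n \<Rightarrow> real \<Rightarrow> real"
      by (rule sum.cong) (auto simp: \<eta>_def)
    have \<eta>z: "\<eta> z = \<delta> z - t / w z" and \<eta>y: "\<eta> y = \<delta> y + t / w y"
      using False by (auto simp: \<eta>_def)
    have "\<eta> x \<ge> 0" if "x \<in> N" for x
      using \<delta>[OF that] tz t(1) wy by (auto simp: \<eta>_def)
    moreover have "(\<Sum>x\<in>N. w x * \<eta> x) = (\<Sum>x\<in>N. w x * \<delta> x)"
      unfolding split rest[of "\<lambda>x d. w x * d"] \<eta>z \<eta>y using wz wy by (simp add: algebra_simps)
    ultimately have "(\<Sum>x\<in>N. w x * ((a x)\<^sup>2 / (1 + \<beta> * \<delta> x))) \<le> (\<Sum>x\<in>N. w x * ((a x)\<^sup>2 / (1 + \<beta> * \<eta> x)))"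
      by (rule min)
    then have "w z * ((a z)\<^sup>2 / s z) + w y * ((a y)\<^sup>2 / s y) \<le>
        w z * ((a z)\<^sup>2 / (s z - \<beta> * (t / w z))) + w y * ((a y)\<^sup>2 / (s y + \<beta> * (t / w y)))"
      unfolding split rest[of "\<lambda>x d. w x * ((a x)\<^sup>2 / (1 + \<beta> * d))"] \<eta>z \<eta>y s_def
      by (simp add: algebra_simps)
    moreover have pz: "s z - \<beta> * (t / w z) > 0"
    proof -
      have "\<beta> * (t / w z) < \<beta> * \<delta> z"
        using tz \<beta> by (intro mult_strict_left_mono)
      then show ?thesis
        by (simp add: s_def)
    qed
    have "w z * ((a z)\<^sup>2 / (s z - \<beta> * (t / w z))) - w z * ((a z)\<^sup>2 / s z) = \<beta> * t * r t"
    proof -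
      have *: "p * (A / (q - c)) - p * (A / q) = (p * c) * (A / (q * (q - c)))"
        if "q > 0" "q - c > 0" for p A q c :: real
        using that by (simp add: divide_simps) (simp add: algebra_simps)
      show ?thesis
        unfolding r_def using *[of "s z" "\<beta> * (t / w z)" "w z" "(a z)\<^sup>2"] pz s[OF zy(1)] wz by simp
    qed
    moreover have "w y * ((a y)\<^sup>2 / s y) - w y * ((a y)\<^sup>2 / (s y + \<beta> * (t / w y))) = \<beta> * t * l t"
    proof -
      have *: "p * (A / q) - p * (A / (q + c)) = (p * c) * (A / (q * (q + c)))"
        if "q > 0" "q + c > 0" for p A q c :: real
        using that by (simp add: divide_simps) (simp add: algebra_simps)
      have "s y + \<beta> * (t / w y) > 0"
        using s[OF zy(2)] \<beta> t(1) wy by (intro add_pos_pos) auto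
      then show ?thesis
        unfolding l_def using *[of "s y" "\<beta> * (t / w y)" "w y" "(a y)\<^sup>2"] s[OF zy(2)] wy by simp
    qed
    ultimately have "\<beta> * t * l t \<le> \<beta> * t * r t"
      by linarith
    then show ?thesis
      using \<beta> t(1) by simp
  qed
  have "(l \<longlongrightarrow> (a y)\<^sup>2 / (s y * (s y + \<beta> * (0 / w y)))) (at_right 0)"
    unfolding l_def using s[OF zy(2)] w[OF zy(2)] by (intro tendsto_intros) auto
  moreover have "(r \<longlongrightarrow> (a z)\<^sup>2 / (s z * (s z - \<beta> * (0 / w z)))) (at_right 0)"
    unfolding r_def using s[OF zy(1)] w[OF zy(1)] by (intro tendsto_intros) auto
  moreover have "eventually (\<lambda>t. l t \<le> r t) (at_right 0)"
  proof -
    have "w z * \<delta> z > 0"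
      using w zy by simp
    then show ?thesis
      using eventually_at_right_less[of 0] le by (auto simp: eventually_at_right_field intro!: exI[of _ "w z * \<delta> z"])
  qed
  ultimately have "(a y)\<^sup>2 / (s y * (s y + \<beta> * (0 / w y))) \<le> (a z)\<^sup>2 / (s z * (s z - \<beta> * (0 / w z)))"
    by (intro tendsto_le[of "at_right 0"]) auto
  then show ?thesis
    by (simp add: s_def power_divide power2_eq_square)
qed simp

text \<open>\<open>C\<close> is the quotient at some node carrying mass. By the mass shift it
  dominates all quotients, with equality wherever there is mass; solving that equality for
  \<open>\<delta> x\<close> gives the threshold formula. Without mass the quotient is
  \<open>\<bar>a x\<bar>\<close>, so the positive part vanishes. \<open>nz\<close> keeps
  \<open>C\<close> away from 0.\<close>

lemma minimal_distribution_threshold: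
  fixes w a \<delta> :: "'n \<Rightarrow> real"
  assumes fin: "finite N" and w: "\<And>x. x \<in> N \<Longrightarrow> w x > 0" and \<beta>: "\<beta> > 0"
    and \<delta>: "\<And>x. x \<in> N \<Longrightarrow> \<delta> x \<ge> 0" and m: "(\<Sum>x\<in>N. w x * \<delta> x) > 0"
    and min: "\<And>\<eta>. (\<And>x. x \<in> N \<Longrightarrow> \<eta> x \<ge> 0) \<Longrightarrow> (\<Sum>x\<in>N. w x * \<eta> x) = (\<Sum>x\<in>N. w x * \<delta> x) \<Longrightarrow>
      (\<Sum>x\<in>N. w x * ((a x)\<^sup>2 / (1 + \<beta> * \<delta> x))) \<le> (\<Sum>x\<in>N. w x * ((a x)\<^sup>2 / (1 + \<beta> * \<eta> x)))"
    and nz: "\<exists>x\<in>N. a x \<noteq> 0"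
  shows "\<exists>C>0. \<forall>x\<in>N. \<delta> x = 1 / (\<beta> * C) * pos_part (\<bar>a x\<bar> - C)"
proof -
  have "\<exists>z\<in>N. \<delta> z > 0"
  proof (rule ccontr)
    assume "\<not> ?thesis"
    then have "(\<Sum>x\<in>N. w x * \<delta> x) = (\<Sum>x\<in>N. 0)"
      using \<delta> by (intro sum.cong) force+
    then show False
      using m by simp
  qed
  then obtain z where z: "z \<in> N" "\<delta> z > 0"
    by blast
  define C where "C = \<bar>a z\<bar> / (1 + \<beta> * \<delta> z)"
  have s: "1 + \<beta> * \<delta> x > 0" if "x \<in> N" for x
    using \<delta>[OF that] \<beta> by (intro add_pos_nonneg) auto
  have shift: "\<bar>a y\<bar> / (1 + \<beta> * \<delta> y) \<le> \<bar>a x\<bar> / (1 + \<beta> * \<delta> x)"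
    if "x \<in> N" "y \<in> N" "\<delta> x > 0" for x y
  proof -
    have "(a y / (1 + \<beta> * \<delta> y))\<^sup>2 \<le> (a x / (1 + \<beta> * \<delta> x))\<^sup>2"
      by (rule mass_shift_inequality[OF fin w \<beta> \<delta> min that])
    then show ?thesis
      using s[OF that(1)] s[OF that(2)] by (simp add: abs_le_square_iff[symmetric])
  qed
  obtain y where y: "y \<in> N" "a y \<noteq> 0"
    using nz by blast
  have "0 < \<bar>a y\<bar> / (1 + \<beta> * \<delta> y)"
    using y s by simp
  then have C: "C > 0"
    using shift[OF z(1) y(1) z(2)] by (simp add: C_def)
  have "\<delta> x = 1 / (\<beta> * C) * pos_part (\<bar>a x\<bar> - C)" if x: "x \<in> N" for x
  proof (cases "\<delta> x > 0")
    case True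
    then have "\<bar>a x\<bar> / (1 + \<beta> * \<delta> x) = C"
      using shift[OF x z(1) True] shift[OF z(1) x z(2)] by (simp add: C_def)
    then have "\<bar>a x\<bar> = C * (1 + \<beta> * \<delta> x)"
      using s[OF x] by (auto simp: field_simps)
    then have "\<bar>a x\<bar> - C = \<beta> * C * \<delta> x"
      by (simp add: algebra_simps)
    moreover have "\<dots> \<ge> 0"
      using C \<beta> True by simp
    ultimately show ?thesis
      using C \<beta> by (simp add: pos_part_def)
  next
    case False
    then have "\<delta> x = 0"
      using \<delta>[OF x] by simp
    then show ?thesis
      using shift[OF z(1) x z(2)] by (simp add: pos_part_def C_def)
  qed
  then show ?thesis
    using C by blast
qed

section \<open>The energy in terms of nodal values\<close>

locale insulation_energy = boundary_part_mesh \<T> \<Omega> \<Gamma>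
  for \<T> :: "'a::euclidean_space set set" and \<Omega> \<Gamma> :: "'a set" +
  fixes \<Gamma>N :: "'a set" and \<kappa> \<beta> m :: real and f g uinf :: "'a \<Rightarrow> real"
  assumes \<kappa>_pos: "\<kappa> > 0" and \<beta>_pos: "\<beta> > 0" and m_pos: "m > 0"
    and part_nonempty: "\<Gamma> \<noteq> {}"
    and openin_other_part: "openin (top_of_set (frontier \<Omega>)) \<Gamma>N"
    and f: "f \<in> S1 \<Omega> \<T>" and g: "g \<in> S1_bd \<Omega> \<T> \<Gamma>N"
    and load_nonzero: "ip_L2 \<Omega> f (\<lambda>_. 1) + ip_bd \<Omega> \<T> \<Gamma>N g (\<lambda>_. 1) \<noteq> 0"
begin

abbreviation dirichlet :: "('a \<Rightarrow> real) \<Rightarrow> ('a \<Rightarrow> real) \<Rightarrow> real" where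
  "dirichlet u v \<equiv> ip_L2 \<Omega> (grad u) (grad v)"

definition load :: "('a \<Rightarrow> real) \<Rightarrow> real" where
  "load v = ip_L2 \<Omega> f v + ip_bd \<Omega> \<T> \<Gamma>N g v"

definition energy :: "('a \<Rightarrow> real) \<Rightarrow> ('a \<Rightarrow> real) \<Rightarrow> real" where
  "energy v \<eta> = \<kappa> / 2 * dirichlet v v
    + \<beta> / 2 * (\<Sum>z\<in>nodes. weight z * ((v z - uinf z)\<^sup>2 / (1 + \<beta> * \<eta> z))) - load v"

text \<open>The derivative of \<open>energy\<close> in its first argument at \<open>u\<close> in
  direction \<open>v\<close>; its vanishing for all \<open>v\<close> is condition (iii).\<close>

definition slope :: "('a \<Rightarrow> real) \<Rightarrow> ('a \<Rightarrow> real) \<Rightarrow> ('a \<Rightarrow> real) \<Rightarrow> real" where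
  "slope u \<eta> v = \<kappa> * dirichlet u v
    + \<beta> * ip_lumped \<Omega> \<T> \<Gamma> (\<lambda>x. inverse (1 + \<beta> * \<eta> x) * (u x - uinf x)) v - load v"

lemma nodes_nonempty: "nodes \<noteq> {}"
proof -
  obtain F where F: "F \<in> facets_on \<Omega> \<T> \<Gamma>"
    using part_nonempty closure_eq_facets by fastforce
  then have "F \<noteq> {}"
    using facets_on_boundary by (metis boundary_facetE facet_of_def)
  then show ?thesis
    using facet_vertices[OF F] by (metis convex_hull_empty subset_empty)
qed

text \<open>Nodes may lie in the closure of \<open>\<Gamma>\<close> without lying in
  \<open>\<Gamma>\<close>: continuity carries the sign to them, and facet-wise affinity carries it
  back.\<close>

lemma H_adm_iff:
  assumes "\<eta> \<in> S1_bd \<Omega> \<T> \<Gamma>"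
  shows "\<eta> \<in> H_adm \<Omega> \<T> \<Gamma> m \<longleftrightarrow>
    (\<forall>z\<in>nodes. \<eta> z \<ge> 0) \<and> (\<Sum>z\<in>nodes. weight z * \<eta> z) = m"
proof -
  have "(\<forall>x\<in>\<Gamma>. 0 \<le> \<eta> x) \<longleftrightarrow> (\<forall>z\<in>nodes. 0 \<le> \<eta> z)"
  proof
    assume "\<forall>x\<in>\<Gamma>. 0 \<le> \<eta> x"
    moreover have "continuous_on (closure \<Gamma>) \<eta>"
      using assms by (simp add: S1_bd_def)
    ultimately have "0 \<le> \<eta> x" if "x \<in> closure \<Gamma>" for x
      using continuous_ge_on_closure[OF _ that, of \<eta> 0] by blast
    then show "\<forall>z\<in>nodes. 0 \<le> \<eta> z"
      by blast
  next
    assume "\<forall>z\<in>nodes. 0 \<le> \<eta> z"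
    then show "\<forall>x\<in>\<Gamma>. 0 \<le> \<eta> x"
      using S1_bd_nonneg[OF assms] closure_subset[of \<Gamma>] by blast
  qed
  then show ?thesis
    using assms by (simp add: H_adm_def ip_lumped_eq_sum)
qed

lemma E_h_eq:
  assumes "\<eta> \<in> S1_bd \<Omega> \<T> \<Gamma>"
  shows "E_h \<Omega> \<T> \<Gamma> \<Gamma>N \<kappa> \<beta> m f g uinf v \<eta> =
    (if \<eta> \<in> H_adm \<Omega> \<T> \<Gamma> m then ereal (energy v \<eta>) else \<infinity>)"
proof (cases "\<eta> \<in> H_adm \<Omega> \<T> \<Gamma> m")
  case True
  have "weight z * ((1 + \<beta> * \<eta> z) powr (- 1 / 2) * (v z - uinf z))\<^sup>2 =
      weight z * ((v z - uinf z)\<^sup>2 / (1 + \<beta> * \<eta> z))" if "z \<in> nodes" for z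
  proof -
    have "\<eta> z \<ge> 0"
      using True that H_adm_iff[OF assms] by blast
    then have "1 + \<beta> * \<eta> z > 0"
      using \<beta>_pos by (intro add_pos_nonneg) auto
    then have "((1 + \<beta> * \<eta> z) powr (- 1 / 2))\<^sup>2 = 1 / (1 + \<beta> * \<eta> z)"
      by (simp add: power2_eq_square powr_add[symmetric] powr_minus_divide)
    then show ?thesis
      by (simp add: power_mult_distrib)
  qed
  then have "(norm_lumped \<Omega> \<T> \<Gamma> (\<lambda>x. (1 + \<beta> * \<eta> x) powr (- 1 / 2) * (v x - uinf x)))\<^sup>2 =
      (\<Sum>z\<in>nodes. weight z * ((v z - uinf z)\<^sup>2 / (1 + \<beta> * \<eta> z)))"
    unfolding norm_lumped_power2 by (intro sum.cong refl)
  moreover have "(norm_L2 \<Omega> (grad v))\<^sup>2 = dirichlet v v"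
    by (simp add: norm_L2_def ip_L2_self_nonneg)
  ultimately show ?thesis
    using True by (simp add: E_h_def energy_def load_def)
qed (simp add: E_h_def)

lemma load_add_scaled:
  assumes "v \<in> S1 \<Omega> \<T>" "w \<in> S1 \<Omega> \<T>"
  shows "load (\<lambda>x. v x + t * w x) = load v + t * load w"
proof -
  have "closure \<Gamma>N \<subseteq> closure \<Omega>"
    using openin_imp_subset[OF openin_other_part] closure_minimal[of \<Gamma>N "frontier \<Omega>"]
    by (auto simp: frontier_def)
  then have cont: "continuous_on (closure \<Gamma>N) (\<lambda>x. g x * h x)" if "h \<in> S1 \<Omega> \<T>" for h
    using that g continuous_on_subset[of "closure \<Omega>" h "closure \<Gamma>N"]
    by (auto simp: S1_def S1_bd_def intro!: continuous_intros)
  have "ip_bd \<Omega> \<T> \<Gamma>N g (\<lambda>x. v x + t * w x) =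
      surface_integral \<Omega> \<T> \<Gamma>N (\<lambda>x. g x * v x + t * (g x * w x))"
    by (simp add: ip_bd_def algebra_simps)
  also have "\<dots> = ip_bd \<Omega> \<T> \<Gamma>N g v + t * ip_bd \<Omega> \<T> \<Gamma>N g w"
    using surface_integral_add_scaled[OF openin_other_part cont cont] assms by (simp add: ip_bd_def)
  finally show ?thesis
    using ip_L2_add_scaled[OF f assms] by (simp add: load_def algebra_simps)
qed

lemma dirichlet_add_scaled:
  assumes "u \<in> S1 \<Omega> \<T>" "v \<in> S1 \<Omega> \<T>"
  shows "dirichlet (\<lambda>x. u x + t * v x) (\<lambda>x. u x + t * v x) =
    dirichlet u u + 2 * t * dirichlet u v + t\<^sup>2 * dirichlet v v"
proof -
  have "dirichlet (\<lambda>x. u x + t * v x) (\<lambda>x. u x + t * v x) =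
      dirichlet (\<lambda>x. u x + t * v x) u + t * dirichlet (\<lambda>x. u x + t * v x) v"
    using S1_add_scaled assms by (intro ip_L2_grad_add_scaled)
  moreover have "dirichlet (\<lambda>x. u x + t * v x) u = dirichlet u u + t * dirichlet u v"
    by (subst ip_L2_commute) (rule ip_L2_grad_add_scaled[OF assms(1) assms])
  moreover have "dirichlet (\<lambda>x. u x + t * v x) v = dirichlet v u + t * dirichlet v v"
    by (subst ip_L2_commute) (rule ip_L2_grad_add_scaled[OF assms(2) assms])
  moreover have "dirichlet v u = dirichlet u v"
    by (rule ip_L2_commute)
  ultimately show ?thesis
    by (simp add: power2_eq_square algebra_simps)
qed

text \<open>For fixed \<open>\<eta>\<close> the energy is a quadratic polynomial in the state, so
  the second-order expansion is exact.\<close>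

lemma energy_add_scaled:
  assumes "u \<in> S1 \<Omega> \<T>" "v \<in> S1 \<Omega> \<T>"
  shows "energy (\<lambda>x. u x + t * v x) \<eta> = energy u \<eta> + t * slope u \<eta> v
    + t\<^sup>2 * (\<kappa> / 2 * dirichlet v v + \<beta> / 2 * (\<Sum>z\<in>nodes. weight z * ((v z)\<^sup>2 / (1 + \<beta> * \<eta> z))))"
proof -
  have "weight z * ((u z + t * v z - uinf z)\<^sup>2 / (1 + \<beta> * \<eta> z)) =
      weight z * ((u z - uinf z)\<^sup>2 / (1 + \<beta> * \<eta> z))
      + 2 * t * (weight z * (inverse (1 + \<beta> * \<eta> z) * (u z - uinf z) * v z))
      + t\<^sup>2 * (weight z * ((v z)\<^sup>2 / (1 + \<beta> * \<eta> z)))" for z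
    by (simp add: divide_inverse power2_eq_square algebra_simps)
  then have "(\<Sum>z\<in>nodes. weight z * ((u z + t * v z - uinf z)\<^sup>2 / (1 + \<beta> * \<eta> z))) =
      (\<Sum>z\<in>nodes. weight z * ((u z - uinf z)\<^sup>2 / (1 + \<beta> * \<eta> z)))
      + 2 * t * ip_lumped \<Omega> \<T> \<Gamma> (\<lambda>x. inverse (1 + \<beta> * \<eta> x) * (u x - uinf x)) v
      + t\<^sup>2 * (\<Sum>z\<in>nodes. weight z * ((v z)\<^sup>2 / (1 + \<beta> * \<eta> z)))"
    by (simp only: sum.distrib ip_lumped_eq_sum sum_distrib_left)
  then show ?thesis
    unfolding energy_def slope_def dirichlet_add_scaled[OF assms] load_add_scaled[OF assms]
    by (simp only:) (simp add: algebra_simps)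
qed

text \<open>Joint convexity, term by term: the Dirichlet part drops the nonnegative square of the
  increment, the boundary part uses the tangent plane at each node, the load is linear. In
  \<open>\<beta>\<^sup>2 / 2\<close>, one factor \<open>\<beta>\<close> comes from the energy and
  one from \<open>s = 1 + \<beta> * \<eta>\<close>.\<close>

lemma energy_tangent:
  assumes u: "u \<in> S1 \<Omega> \<T>" and v: "v \<in> S1 \<Omega> \<T>"
    and nonneg: "\<And>z. z \<in> nodes \<Longrightarrow> \<delta> z \<ge> 0" "\<And>z. z \<in> nodes \<Longrightarrow> \<eta> z \<ge> 0"
  shows "energy u \<delta> + slope u \<delta> (\<lambda>x. v x - u x)
      - \<beta>\<^sup>2 / 2 * (\<Sum>z\<in>nodes. weight z * (((u z - uinf z) / (1 + \<beta> * \<delta> z))\<^sup>2 * (\<eta> z - \<delta> z)))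
    \<le> energy v \<eta>"
proof -
  let ?h = "\<lambda>x. v x - u x"
  define R where "R z = weight z * (((u z - uinf z) / (1 + \<beta> * \<delta> z))\<^sup>2 * (\<eta> z - \<delta> z))" for z
  have h: "?h \<in> S1 \<Omega> \<T>"
    using S1_add_scaled[OF v u, of "-1"] by simp
  have d: "dirichlet v v \<ge> dirichlet u u + 2 * dirichlet u ?h"
    using dirichlet_add_scaled[OF u h, of 1] ip_L2_self_nonneg[of \<Omega> "grad ?h"] by simp
  have l: "load v = load u + load ?h"
    using load_add_scaled[OF u h, of 1] by simp
  have "weight z * ((u z - uinf z)\<^sup>2 / (1 + \<beta> * \<delta> z))
      + 2 * (weight z * (inverse (1 + \<beta> * \<delta> z) * (u z - uinf z) * ?h z)) - \<beta> * R z
      \<le> weight z * ((v z - uinf z)\<^sup>2 / (1 + \<beta> * \<eta> z))" if z: "z \<in> nodes" for z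
  proof -
    have "1 + \<beta> * \<delta> z > 0" "1 + \<beta> * \<eta> z > 0"
      using nonneg z \<beta>_pos by (auto intro: add_pos_nonneg)
    from quotient_square_tangent[OF this, of "u z - uinf z" "v z - uinf z"]
    have "weight z * ((u z - uinf z)\<^sup>2 / (1 + \<beta> * \<delta> z)
        + 2 * ((u z - uinf z) / (1 + \<beta> * \<delta> z)) * (v z - uinf z - (u z - uinf z))
        - ((u z - uinf z) / (1 + \<beta> * \<delta> z))\<^sup>2 * (1 + \<beta> * \<eta> z - (1 + \<beta> * \<delta> z)))
        \<le> weight z * ((v z - uinf z)\<^sup>2 / (1 + \<beta> * \<eta> z))"
      using weight_pos[OF z] by (intro mult_left_mono) auto
    moreover have "weight z * ((u z - uinf z)\<^sup>2 / (1 + \<beta> * \<delta> z)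
        + 2 * ((u z - uinf z) / (1 + \<beta> * \<delta> z)) * (v z - uinf z - (u z - uinf z))
        - ((u z - uinf z) / (1 + \<beta> * \<delta> z))\<^sup>2 * (1 + \<beta> * \<eta> z - (1 + \<beta> * \<delta> z))) =
      weight z * ((u z - uinf z)\<^sup>2 / (1 + \<beta> * \<delta> z))
      + 2 * (weight z * (inverse (1 + \<beta> * \<delta> z) * (u z - uinf z) * ?h z)) - \<beta> * R z"
      unfolding R_def divide_inverse by algebra
    ultimately show ?thesis
      by linarith
  qed
  then have "(\<Sum>z\<in>nodes. weight z * ((u z - uinf z)\<^sup>2 / (1 + \<beta> * \<delta> z))
      + 2 * (weight z * (inverse (1 + \<beta> * \<delta> z) * (u z - uinf z) * ?h z)) - \<beta> * R z)
      \<le> (\<Sum>z\<in>nodes. weight z * ((v z - uinf z)\<^sup>2 / (1 + \<beta> * \<eta> z)))"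
    by (rule sum_mono)
  then have s: "(\<Sum>z\<in>nodes. weight z * ((u z - uinf z)\<^sup>2 / (1 + \<beta> * \<delta> z)))
      + 2 * ip_lumped \<Omega> \<T> \<Gamma> (\<lambda>x. inverse (1 + \<beta> * \<delta> x) * (u x - uinf x)) ?h
      - \<beta> * (\<Sum>z\<in>nodes. R z)
      \<le> (\<Sum>z\<in>nodes. weight z * ((v z - uinf z)\<^sup>2 / (1 + \<beta> * \<eta> z)))"
    by (simp only: sum.distrib sum_subtractf ip_lumped_eq_sum sum_distrib_left)
  have "\<kappa> / 2 * (dirichlet u u + 2 * dirichlet u ?h) \<le> \<kappa> / 2 * dirichlet v v"
    using d \<kappa>_pos by (intro mult_left_mono) auto
  moreover note mult_left_mono[OF s, of "\<beta> / 2"]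
  ultimately show ?thesis
    using \<beta>_pos unfolding energy_def slope_def l R_def[symmetric]
    by (simp add: power2_eq_square algebra_simps)
qed

section \<open>Equivalence of minimality and the optimality conditions\<close>

definition threshold_condition :: "real \<Rightarrow> ('a \<Rightarrow> real) \<Rightarrow> ('a \<Rightarrow> real) \<Rightarrow> bool" where
  "threshold_condition C u \<delta> \<longleftrightarrow>
    (\<forall>z\<in>nodes. \<delta> z = 1 / (\<beta> * C) * pos_part (\<bar>u z - uinf z\<bar> - C)) \<and>
    (\<Sum>z\<in>nodes. weight z * \<delta> z) = m"

text \<open>Given (ii), the norm in (i) equals \<open>\<beta> * C\<close> times the mass of
  \<open>\<delta>\<close>, so (i) is precisely the mass constraint.\<close>

lemma threshold_condition_iff:
  assumes C: "C > 0" and \<delta>: "\<delta> \<in> S1_bd \<Omega> \<T> \<Gamma>"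
  shows "threshold_condition C u \<delta> \<longleftrightarrow>
    C = 1 / (\<beta> * m) * norm_L1_bd \<Omega> \<T> \<Gamma> (I_h (\<lambda>x. pos_part (\<bar>u x - uinf x\<bar> - C))) \<and>
    (\<forall>x\<in>\<Gamma>. \<delta> x = 1 / (\<beta> * C) * I_h (\<lambda>x. pos_part (\<bar>u x - uinf x\<bar> - C)) x)"
    (is "_ \<longleftrightarrow> ?mass \<and> ?formula")
proof -
  let ?\<phi> = "\<lambda>x. pos_part (\<bar>u x - uinf x\<bar> - C)"
  let ?w = "\<lambda>x. 1 / (\<beta> * C) * I_h ?\<phi> x"
  have w: "?w \<in> S1_bd \<Omega> \<T> \<Gamma>"
    using S1_bd_add_scaled[OF S1_bd_const nodal_interp_in_S1_bd, of 0 "1 / (\<beta> * C)" ?\<phi>] by simp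
  have formula: "?formula \<longleftrightarrow> (\<forall>z\<in>nodes. \<delta> z = 1 / (\<beta> * C) * ?\<phi> z)"
  proof
    assume eq: ?formula
    \<comment> \<open>The formula is known on \<open>\<Gamma>\<close> only and has to be extended to
      nodes in the closure.\<close>
    have "continuous_on (closure \<Gamma>) (\<lambda>x. \<delta> x - ?w x)"
      using \<delta> w by (intro continuous_on_diff) (auto simp: S1_bd_def)
    moreover have "\<delta> x - ?w x = 0" if "x \<in> \<Gamma>" for x
      using bspec[OF eq that] by (simp only: diff_self)
    ultimately have "\<delta> x - ?w x = 0" if "x \<in> closure \<Gamma>" for x
      using that by (rule continuous_constant_on_closure)
    then have "\<delta> z = ?w z" if "z \<in> nodes" for z
      using that by (simp only: right_minus_eq Int_iff)
    then show "\<forall>z\<in>nodes. \<delta> z = 1 / (\<beta> * C) * ?\<phi> z"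
      using nodal_interp_node[of _ ?\<phi>] by simp
  next
    assume "\<forall>z\<in>nodes. \<delta> z = 1 / (\<beta> * C) * ?\<phi> z"
    then have "\<delta> x = ?w x" if "x \<in> closure \<Gamma>" for x
      using S1_bd_eqI[OF \<delta> w _ that] nodal_interp_node[of _ ?\<phi>] by simp
    then show ?formula
      using closure_subset by blast
  qed
  have norm: "norm_L1_bd \<Omega> \<T> \<Gamma> (I_h ?\<phi>) = (\<Sum>z\<in>nodes. weight z * ?\<phi> z)"
    by (rule norm_L1_bd_nodal_interp) (simp add: pos_part_def)
  have "?mass \<longleftrightarrow> (\<Sum>z\<in>nodes. weight z * \<delta> z) = m"
    if eq: "\<forall>z\<in>nodes. \<delta> z = 1 / (\<beta> * C) * ?\<phi> z"
  proof -
    have "(\<Sum>z\<in>nodes. weight z * \<delta> z) = (\<Sum>z\<in>nodes. 1 / (\<beta> * C) * (weight z * ?\<phi> z))"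
      using eq by (intro sum.cong) auto
    then have "(\<Sum>z\<in>nodes. weight z * \<delta> z) = 1 / (\<beta> * C) * (\<Sum>z\<in>nodes. weight z * ?\<phi> z)"
      by (simp only: sum_distrib_left)
    moreover have "C = 1 / (\<beta> * m) * S \<longleftrightarrow> 1 / (\<beta> * C) * S = m" for S
      using C \<beta>_pos m_pos by (auto simp: field_simps)
    ultimately show ?thesis
      unfolding norm by (simp only:)
  qed
  then show ?thesis
    unfolding threshold_condition_def formula by blast
qed

text \<open>\<open>C\<^sup>2\<close> acts, up to a factor, as multiplier of the mass constraint:
  complementarity bounds the tangent term by \<open>C\<^sup>2\<close> times the difference of the
  masses of \<open>\<eta>\<close> and \<open>\<delta>\<close>, which is zero.\<close>

lemma optimality_conditions_imp_minimal:
  assumes u: "u \<in> S1 \<Omega> \<T>" and C: "C > 0" and th: "threshold_condition C u \<delta>"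
    and stat: "\<And>v. v \<in> S1 \<Omega> \<T> \<Longrightarrow> slope u \<delta> v = 0"
    and v: "v \<in> S1 \<Omega> \<T>" and \<eta>: "\<And>z. z \<in> nodes \<Longrightarrow> \<eta> z \<ge> 0" "(\<Sum>z\<in>nodes. weight z * \<eta> z) = m"
  shows "energy u \<delta> \<le> energy v \<eta>"
proof -
  let ?\<rho> = "\<lambda>z. ((u z - uinf z) / (1 + \<beta> * \<delta> z))\<^sup>2"
  have \<delta>: "\<delta> z = 1 / (\<beta> * C) * pos_part (\<bar>u z - uinf z\<bar> - C)" if "z \<in> nodes" for z
    using th that by (simp add: threshold_condition_def)
  have \<delta>_nonneg: "\<delta> z \<ge> 0" if "z \<in> nodes" for z
    using \<delta>[OF that] \<beta>_pos C by (simp add: pos_part_def)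
  have tangent: "energy u \<delta> + slope u \<delta> (\<lambda>x. v x - u x)
      - \<beta>\<^sup>2 / 2 * (\<Sum>z\<in>nodes. weight z * (?\<rho> z * (\<eta> z - \<delta> z))) \<le> energy v \<eta>"
    by (rule energy_tangent[OF u v]) (rule \<delta>_nonneg \<eta>(1), assumption)+
  have "(\<lambda>x. v x - u x) \<in> S1 \<Omega> \<T>"
    using S1_add_scaled[OF v u, of "-1"] by simp
  then have "slope u \<delta> (\<lambda>x. v x - u x) = 0"
    by (rule stat)
  moreover have "(\<Sum>z\<in>nodes. weight z * (?\<rho> z * (\<eta> z - \<delta> z))) \<le> 0"
  proof -
    have "weight z * (?\<rho> z * (\<eta> z - \<delta> z)) \<le> C\<^sup>2 * (weight z * \<eta> z) - C\<^sup>2 * (weight z * \<delta> z)"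
      if z: "z \<in> nodes" for z
    proof -
      have "?\<rho> z * \<eta> z \<le> C\<^sup>2 * \<eta> z"
        using pos_part_threshold(1)[OF \<beta>_pos C \<delta>[OF z]] \<eta>(1)[OF z] by (intro mult_right_mono)
      moreover have "\<delta> z * ?\<rho> z = \<delta> z * C\<^sup>2"
        by (rule pos_part_threshold(2)[OF \<beta>_pos C \<delta>[OF z]])
      ultimately have "?\<rho> z * (\<eta> z - \<delta> z) \<le> C\<^sup>2 * (\<eta> z - \<delta> z)"
        by (simp only: right_diff_distrib mult.commute[of _ "\<delta> z"])
      then have "weight z * (?\<rho> z * (\<eta> z - \<delta> z)) \<le> weight z * (C\<^sup>2 * (\<eta> z - \<delta> z))"
        using weight_pos[OF z] by (intro mult_left_mono) auto
      then show ?thesis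
        by (simp add: algebra_simps)
    qed
    then have "(\<Sum>z\<in>nodes. weight z * (?\<rho> z * (\<eta> z - \<delta> z)))
        \<le> (\<Sum>z\<in>nodes. C\<^sup>2 * (weight z * \<eta> z) - C\<^sup>2 * (weight z * \<delta> z))"
      by (rule sum_mono)
    also have "\<dots> = C\<^sup>2 * (\<Sum>z\<in>nodes. weight z * \<eta> z) - C\<^sup>2 * (\<Sum>z\<in>nodes. weight z * \<delta> z)"
      by (simp only: sum_subtractf sum_distrib_left)
    also have "\<dots> = 0"
      using \<eta>(2) th unfolding threshold_condition_def by (simp only: diff_self)
    finally show ?thesis .
  qed
  then have "\<beta>\<^sup>2 / 2 * (\<Sum>z\<in>nodes. weight z * (?\<rho> z * (\<eta> z - \<delta> z))) \<le> 0"
    by (intro mult_nonneg_nonpos) auto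
  ultimately show ?thesis
    using tangent by linarith
qed

lemma minimal_imp_optimality_conditions:
  assumes u: "u \<in> S1 \<Omega> \<T>" and \<delta>: "\<delta> \<in> S1_bd \<Omega> \<T> \<Gamma>" "\<And>z. z \<in> nodes \<Longrightarrow> \<delta> z \<ge> 0"
      "(\<Sum>z\<in>nodes. weight z * \<delta> z) = m"
    and min: "\<And>v \<eta>. v \<in> S1 \<Omega> \<T> \<Longrightarrow> \<eta> \<in> S1_bd \<Omega> \<T> \<Gamma> \<Longrightarrow> (\<And>z. z \<in> nodes \<Longrightarrow> \<eta> z \<ge> 0) \<Longrightarrow>
      (\<Sum>z\<in>nodes. weight z * \<eta> z) = m \<Longrightarrow> energy u \<delta> \<le> energy v \<eta>"
  shows "\<exists>C>0. threshold_condition C u \<delta>" "v \<in> S1 \<Omega> \<T> \<Longrightarrow> slope u \<delta> v = 0"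
proof -
  have stat: "slope u \<delta> v = 0" if v: "v \<in> S1 \<Omega> \<T>" for v
  proof (rule quadratic_nonneg_imp_linear_zero)
    fix t
    have "energy u \<delta> \<le> energy (\<lambda>x. u x + t * v x) \<delta>"
      using S1_add_scaled[OF u v] \<delta> by (intro min)
    then show "0 \<le> t * slope u \<delta> v + t\<^sup>2 * (\<kappa> / 2 * dirichlet v v
        + \<beta> / 2 * (\<Sum>z\<in>nodes. weight z * ((v z)\<^sup>2 / (1 + \<beta> * \<delta> z))))"
      unfolding energy_add_scaled[OF u v] by linarith
  qed
  then show "v \<in> S1 \<Omega> \<T> \<Longrightarrow> slope u \<delta> v = 0" .
  \<comment> \<open>If \<open>u\<close> matched \<open>uinf\<close> at every boundary node, the test
    function 1 would reduce the stationarity condition to a vanishing total load.\<close>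
  have nz: "\<exists>z\<in>nodes. u z - uinf z \<noteq> 0"
  proof (rule ccontr)
    assume "\<not> ?thesis"
    then have "ip_lumped \<Omega> \<T> \<Gamma> (\<lambda>x. inverse (1 + \<beta> * \<delta> x) * (u x - uinf x)) (\<lambda>_. 1) = 0"
      unfolding ip_lumped_eq_sum by (intro sum.neutral) auto
    moreover have "dirichlet u (\<lambda>_. 1) = 0"
      by (simp add: grad_const ip_L2_def set_lebesgue_integral_def)
    ultimately show False
      using stat[OF S1_const, of 1] load_nonzero by (simp add: slope_def load_def)
  qed
  \<comment> \<open>Only the distribution is varied here, with the state kept at \<open>u\<close>.
    An arbitrary \<open>\<eta>\<close> is replaced by its interpolant, which has the same nodal
    values and is an admissible competitor.\<close>
  have dist: "(\<Sum>z\<in>nodes. weight z * ((u z - uinf z)\<^sup>2 / (1 + \<beta> * \<delta> z)))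
      \<le> (\<Sum>z\<in>nodes. weight z * ((u z - uinf z)\<^sup>2 / (1 + \<beta> * \<eta> z)))"
    if \<eta>: "\<And>z. z \<in> nodes \<Longrightarrow> \<eta> z \<ge> 0" "(\<Sum>z\<in>nodes. weight z * \<eta> z) = (\<Sum>z\<in>nodes. weight z * \<delta> z)"
    for \<eta>
  proof -
    have sums: "(\<Sum>z\<in>nodes. h z (I_h \<eta> z)) = (\<Sum>z\<in>nodes. h z (\<eta> z))" for h :: "'a \<Rightarrow> real \<Rightarrow> real"
      by (rule sum.cong) (auto simp: nodal_interp_node)
    have "energy u \<delta> \<le> energy u (I_h \<eta>)"
      using u nodal_interp_in_S1_bd
    proof (rule min)
      show "I_h \<eta> z \<ge> 0" if "z \<in> nodes" for z
        using that \<eta>(1) by (simp add: nodal_interp_node)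
      show "(\<Sum>z\<in>nodes. weight z * I_h \<eta> z) = m"
        unfolding sums[of "\<lambda>z d. weight z * d"] using \<eta>(2) \<delta>(3) by simp
    qed
    then have "\<beta> / 2 * (\<Sum>z\<in>nodes. weight z * ((u z - uinf z)\<^sup>2 / (1 + \<beta> * \<delta> z)))
        \<le> \<beta> / 2 * (\<Sum>z\<in>nodes. weight z * ((u z - uinf z)\<^sup>2 / (1 + \<beta> * \<eta> z)))"
      unfolding energy_def sums[of "\<lambda>z d. weight z * ((u z - uinf z)\<^sup>2 / (1 + \<beta> * d))"] by linarith
    then show ?thesis
      using \<beta>_pos by simp
  qed
  have mass: "(\<Sum>z\<in>nodes. weight z * \<delta> z) > 0"
    using m_pos \<delta>(3) by (simp only:)
  have "\<exists>C>0. \<forall>z\<in>nodes. \<delta> z = 1 / (\<beta> * C) * pos_part (\<bar>u z - uinf z\<bar> - C)"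
    by (rule minimal_distribution_threshold[OF finite_nodes _ \<beta>_pos _ mass _ nz])
      (fact weight_pos \<delta>(2) dist)+
  then show "\<exists>C>0. threshold_condition C u \<delta>"
    using \<delta>(3) by (auto simp: threshold_condition_def)
qed

text \<open>Provides a competitor of finite energy, so that a pair with infinite energy is never
  minimal.\<close>

lemma uniform_distribution_admissible:
  "(\<lambda>_. m / (\<Sum>z\<in>nodes. weight z)) \<in> H_adm \<Omega> \<T> \<Gamma> m"
proof -
  have "(\<Sum>z\<in>nodes. weight z) > 0"
    using finite_nodes nodes_nonempty weight_pos by (rule sum_pos)
  then show ?thesis
    unfolding H_adm_iff[OF S1_bd_const] sum_distrib_right[symmetric] using m_pos by simp
qed

lemma is_arg_min_E_h_iff:
  assumes u: "u \<in> S1 \<Omega> \<T>" and \<delta>: "\<delta> \<in> S1_bd \<Omega> \<T> \<Gamma>"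
  shows "is_arg_min (\<lambda>(v, \<eta>). E_h \<Omega> \<T> \<Gamma> \<Gamma>N \<kappa> \<beta> m f g uinf v \<eta>)
      (\<lambda>p. p \<in> S1 \<Omega> \<T> \<times> S1_bd \<Omega> \<T> \<Gamma>) (u, \<delta>) \<longleftrightarrow>
    \<delta> \<in> H_adm \<Omega> \<T> \<Gamma> m \<and>
    (\<forall>v \<in> S1 \<Omega> \<T>. \<forall>\<eta> \<in> S1_bd \<Omega> \<T> \<Gamma>. \<eta> \<in> H_adm \<Omega> \<T> \<Gamma> m \<longrightarrow> energy u \<delta> \<le> energy v \<eta>)"
proof -
  have "is_arg_min (\<lambda>(v, \<eta>). E_h \<Omega> \<T> \<Gamma> \<Gamma>N \<kappa> \<beta> m f g uinf v \<eta>)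
      (\<lambda>p. p \<in> S1 \<Omega> \<T> \<times> S1_bd \<Omega> \<T> \<Gamma>) (u, \<delta>) \<longleftrightarrow>
    (\<forall>v \<in> S1 \<Omega> \<T>. \<forall>\<eta> \<in> S1_bd \<Omega> \<T> \<Gamma>. \<not> E_h \<Omega> \<T> \<Gamma> \<Gamma>N \<kappa> \<beta> m f g uinf v \<eta>
      < E_h \<Omega> \<T> \<Gamma> \<Gamma>N \<kappa> \<beta> m f g uinf u \<delta>)"
    using assms by (auto simp: is_arg_min_def)
  also have "\<dots> \<longleftrightarrow> \<delta> \<in> H_adm \<Omega> \<T> \<Gamma> m \<and>
    (\<forall>v \<in> S1 \<Omega> \<T>. \<forall>\<eta> \<in> S1_bd \<Omega> \<T> \<Gamma>. \<eta> \<in> H_adm \<Omega> \<T> \<Gamma> m \<longrightarrow> energy u \<delta> \<le> energy v \<eta>)"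
  proof (cases "\<delta> \<in> H_adm \<Omega> \<T> \<Gamma> m")
    case True
    then show ?thesis
      using \<delta> by (auto simp: E_h_eq not_less)
  next
    case False
    have "\<exists>\<eta>\<in>S1_bd \<Omega> \<T> \<Gamma>. \<eta> \<in> H_adm \<Omega> \<T> \<Gamma> m"
      by (rule bexI[OF _ S1_bd_const]) (rule uniform_distribution_admissible)
    then show ?thesis
      using False u \<delta> by (auto simp: E_h_eq)
  qed
  finally show ?thesis .
qed

lemma is_arg_min_iff_optimality_conditions:
  assumes u: "u \<in> S1 \<Omega> \<T>" and \<delta>: "\<delta> \<in> S1_bd \<Omega> \<T> \<Gamma>"
  shows "is_arg_min (\<lambda>(v, \<eta>). E_h \<Omega> \<T> \<Gamma> \<Gamma>N \<kappa> \<beta> m f g uinf v \<eta>)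
      (\<lambda>p. p \<in> S1 \<Omega> \<T> \<times> S1_bd \<Omega> \<T> \<Gamma>) (u, \<delta>) \<longleftrightarrow>
    (\<exists>C>0. threshold_condition C u \<delta> \<and> (\<forall>v \<in> S1 \<Omega> \<T>. slope u \<delta> v = 0))"
  unfolding is_arg_min_E_h_iff[OF assms]
proof
  assume L: "\<delta> \<in> H_adm \<Omega> \<T> \<Gamma> m \<and>
    (\<forall>v \<in> S1 \<Omega> \<T>. \<forall>\<eta> \<in> S1_bd \<Omega> \<T> \<Gamma>. \<eta> \<in> H_adm \<Omega> \<T> \<Gamma> m \<longrightarrow> energy u \<delta> \<le> energy v \<eta>)"
  have adm: "\<forall>z\<in>nodes. \<delta> z \<ge> 0" "(\<Sum>z\<in>nodes. weight z * \<delta> z) = m"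
    using L H_adm_iff[OF \<delta>] by auto
  have min: "energy u \<delta> \<le> energy v \<eta>"
    if "v \<in> S1 \<Omega> \<T>" "\<eta> \<in> S1_bd \<Omega> \<T> \<Gamma>" "\<And>z. z \<in> nodes \<Longrightarrow> \<eta> z \<ge> 0"
      "(\<Sum>z\<in>nodes. weight z * \<eta> z) = m" for v \<eta>
    using L that H_adm_iff[OF that(2)] by blast
  note conds = minimal_imp_optimality_conditions[OF u \<delta> bspec[OF adm(1)] adm(2) min]
  show "\<exists>C>0. threshold_condition C u \<delta> \<and> (\<forall>v \<in> S1 \<Omega> \<T>. slope u \<delta> v = 0)"
    using conds by blast
next
  assume "\<exists>C>0. threshold_condition C u \<delta> \<and> (\<forall>v \<in> S1 \<Omega> \<T>. slope u \<delta> v = 0)"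
  then obtain C where C: "C > 0" "threshold_condition C u \<delta>"
    and stat: "\<And>v. v \<in> S1 \<Omega> \<T> \<Longrightarrow> slope u \<delta> v = 0"
    by blast
  have "\<delta> \<in> H_adm \<Omega> \<T> \<Gamma> m"
    using C \<beta>_pos unfolding H_adm_iff[OF \<delta>] by (auto simp: threshold_condition_def pos_part_def)
  moreover have "energy u \<delta> \<le> energy v \<eta>"
    if "v \<in> S1 \<Omega> \<T>" "\<eta> \<in> S1_bd \<Omega> \<T> \<Gamma>" "\<eta> \<in> H_adm \<Omega> \<T> \<Gamma> m" for v \<eta>
    using optimality_conditions_imp_minimal[OF u C stat that(1)] that(3) H_adm_iff[OF that(2)] by blast
  ultimately show "\<delta> \<in> H_adm \<Omega> \<T> \<Gamma> m \<and>
    (\<forall>v \<in> S1 \<Omega> \<T>. \<forall>\<eta> \<in> S1_bd \<Omega> \<T> \<Gamma>. \<eta> \<in> H_adm \<Omega> \<T> \<Gamma> m \<longrightarrow> energy u \<delta> \<le> energy v \<eta>)"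
    by blast
qed

end

theorem proposition5p1:
  fixes \<Omega> \<Gamma>I \<Gamma>N :: "(real ^ 'd) set"
    and \<TT> :: "(real ^ 'd) set set set" and \<T> :: "(real ^ 'd) set set"
    and \<kappa> \<beta> m :: real
    and f g uinf u \<delta> :: "real ^ 'd \<Rightarrow> real"
  assumes "CARD('d) \<in> {2, 3}"
    and "bounded_polyhedral_lipschitz_domain \<Omega>"
    and "boundary_split \<Omega> \<Gamma>I \<Gamma>N"
    and "\<kappa> > 0" and "\<beta> > 0" and "m > 0"
    and "shape_regular_family \<Omega> \<TT>" and "\<T> \<in> \<TT>"
    and "facets_split \<Omega> \<T> \<Gamma>I \<Gamma>N"
    and "f \<in> S1 \<Omega> \<T>" and "g \<in> S1_bd \<Omega> \<T> \<Gamma>N"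
    and "ip_L2 \<Omega> f (\<lambda>_. 1) + ip_bd \<Omega> \<T> \<Gamma>N g (\<lambda>_. 1) \<noteq> 0"
    and "uinf \<in> S1_bd \<Omega> \<T> \<Gamma>I"
    and "u \<in> S1 \<Omega> \<T>" and "\<delta> \<in> S1_bd \<Omega> \<T> \<Gamma>I"
  shows
    "is_arg_min (\<lambda>(v, \<eta>). E_h \<Omega> \<T> \<Gamma>I \<Gamma>N \<kappa> \<beta> m f g uinf v \<eta>)
        (\<lambda>p. p \<in> S1 \<Omega> \<T> \<times> S1_bd \<Omega> \<T> \<Gamma>I) (u, \<delta>)
     \<longleftrightarrow>
     (\<exists>C>0.
        C = 1 / (\<beta> * m) *
              norm_L1_bd \<Omega> \<T> \<Gamma>I (nodal_interp \<Omega> \<T> \<Gamma>I (\<lambda>x. pos_part (\<bar>u x - uinf x\<bar> - C))) \<and>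
        (\<forall>x \<in> \<Gamma>I. \<delta> x =
              1 / (\<beta> * C) * nodal_interp \<Omega> \<T> \<Gamma>I (\<lambda>x. pos_part (\<bar>u x - uinf x\<bar> - C)) x) \<and>
        (\<forall>v \<in> S1 \<Omega> \<T>.
           \<kappa> * ip_L2 \<Omega> (grad u) (grad v)
           + \<beta> * ip_lumped \<Omega> \<T> \<Gamma>I (\<lambda>x. inverse (1 + \<beta> * \<delta> x) * (u x - uinf x)) v
           = ip_L2 \<Omega> f v + ip_bd \<Omega> \<T> \<Gamma>N g v))"
proof -
  have tri: "triangulation_of \<Omega> \<T>"
    using assms(7,8) by (simp add: shape_regular_family_def)
  have dom: "open \<Omega>" "bounded \<Omega>" "lipschitz_boundary \<Omega>"
    using assms(2) by (auto simp: bounded_polyhedral_lipschitz_domain_def)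
  interpret boundary_part \<T> \<Omega> \<Gamma>I
    using boundary_partI[OF tri dom(1,3) assms(3,9)] .
  interpret insulation_energy \<T> \<Omega> \<Gamma>I \<Gamma>N \<kappa> \<beta> m f g uinf
  proof
    show "\<Union>\<T> = closure \<Omega>"
      using tri by (simp add: triangulation_of_def)
    show "\<Gamma>I \<noteq> {}" "openin (top_of_set (frontier \<Omega>)) \<Gamma>N"
      using assms(3) unfolding boundary_split_def by blast+
  qed (use assms dom in auto)
  have slope: "slope u \<delta> v = 0 \<longleftrightarrow>
      \<kappa> * ip_L2 \<Omega> (grad u) (grad v)
      + \<beta> * ip_lumped \<Omega> \<T> \<Gamma>I (\<lambda>x. inverse (1 + \<beta> * \<delta> x) * (u x - uinf x)) v
      = ip_L2 \<Omega> f v + ip_bd \<Omega> \<T> \<Gamma>N g v" for v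
    by (simp add: slope_def load_def)
  show ?thesis
    unfolding is_arg_min_iff_optimality_conditions[OF assms(14,15)] slope
    using threshold_condition_iff[OF _ assms(15), of _ u] by auto
qed

end
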